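(* Let $\mathcal F,\mathcal G,\mathcal F',\mathcal G'$ be complex separable Hilbert spaces, let $\vartheta\in CM[\mathcal G,\mathcal F]$, and let $$\Xi=\begin{pmatrix}\vartheta_{11}&\vartheta_{12}\\ \vartheta_{21}&\vartheta_{22}\end{pmatrix}\in CM[\mathcal G'\oplus\mathcal G,\mathcal F'\oplus\mathcal F],\qquad \vartheta_{22}=\vartheta,$$ be a regular up-leftward extension of $\vartheta$. Then the block $\vartheta_{11}\in CM[\mathcal G',\mathcal F']$ is uniquely determined by the other three blocks of $\Xi$; that is, if $\Xi'\in CM[\mathcal G'\oplus\mathcal G,\mathcal F'\oplus\mathcal F]$ is also a regular up-leftward extension of $\vartheta$ whose blocks $\vartheta'_{12},\vartheta'_{21}$ coincide with $\vartheta_{12},\vartheta_{21}$ a.e. on the unit circle, then $\vartheta'_{11}=\vartheta_{11}$ a.e.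
   Context: All Hilbert spaces are complex and separable; $[\mathcal G,\mathcal F]$ is the space of bounded linear operators $\mathcal G\to\mathcal F$. $\mathbb T$ is the unit circle; "a.e." refers to Lebesgue measure on $\mathbb T$. $CM[\mathcal G,\mathcal F]$ is the set of (a.e. classes of) measurable $[\mathcal G,\mathcal F]$-valued functions on $\mathbb T$ with essential supremum of the operator norm at most $1$. A unitary coupling is a 6-tuple $\sigma=(\mathcal H,\mathcal F,\mathcal G;U,V_{\mathcal F},V_{\mathcal G})$ where $\mathcal H,\mathcal F,\mathcal G$ are Hilbert spaces, $U$ is a unitary operator on $\mathcal H$, $V_{\mathcal F}:\mathcal F\to\mathcal H$ and $V_{\mathcal G}:\mathcal G\to\mathcal H$ are isometries, and the subspaces $\mathring{\mathcal F}:=\operatorname{ran}V_{\mathcal F}$ and $\mathring{\mathcal G}:=\operatorname{ran}V_{\mathcal G}$ are wandering for $U$ (a subspace $\mathcal N$ is wandering if $U^k\mathcal N\perp U^m\mathcal N$ for all integers $k\ne m$). For a wandering subspace $\mathcal N$ put $M(\mathcal N):=\bigoplus_{k\in\mathbb Z}U^k\mathcal N$. The coupling $\sigma$ is minimal if $\mathcal H=M(\mathring{\mathcal F})\vee M(\mathring{\mathcal G})$ (closed linear span). For an isometry $V_{\mathcal L}:\mathcal L\to\mathcal H$ with wandering range, the Fourier representation $\Phi_U^{V_{\mathcal L}}:\mathcal H\to L^2(\mathbb T;\mathcal L)$ is $[\Phi_U^{V_{\mathcal L}}h](t)=\sum_{k\in\mathbb Z}t^kV_{\mathcal L}^*U^{-k}h$.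 The scattering suboperator of $\sigma$ is the unique $\vartheta_\sigma\in CM[\mathcal G,\mathcal F]$ such that $\Phi_U^{V_{\mathcal F}}(\Phi_U^{V_{\mathcal G}})^*:L^2(\mathbb T;\mathcal G)\to L^2(\mathbb T;\mathcal F)$ is the operator of multiplication by $\vartheta_\sigma$. Every function in $CM[\mathcal G,\mathcal F]$ is the scattering suboperator of a minimal unitary coupling, determined up to unitary equivalence. An up-leftward extension of $\vartheta\in CM[\mathcal G,\mathcal F]$ is a function $\Xi=\begin{pmatrix}\vartheta_{11}&\vartheta_{12}\\ \vartheta_{21}&\vartheta_{22}\end{pmatrix}\in CM[\mathcal G'\oplus\mathcal G,\mathcal F'\oplus\mathcal F]$ with $\vartheta_{22}=\vartheta$. Let $\tau=(\mathcal H,\mathcal F'\oplus\mathcal F,\mathcal G'\oplus\mathcal G;U,V_{\mathcal F'\oplus\mathcal F},V_{\mathcal G'\oplus\mathcal G})$ be a minimal unitary coupling with $\vartheta_\tau=\Xi$, and let $V_{\mathcal F}:=V_{\mathcal F'\oplus\mathcal F}|_{\mathcal F}$, $V_{\mathcal G}:=V_{\mathcal G'\oplus\mathcal G}|_{\mathcal G}$. Then $\tau_{22}:=(\mathcal H,\mathcal F,\mathcal G;U,V_{\mathcal F},V_{\mathcal G})$ is a coupling with $\vartheta_{\tau_{22}}=\vartheta$. The extension $\Xi$ is called regular if $\tau_{22}$ is minimal (this does not depend on the choice of $\tau$). *)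

theory Defs
  imports "HOL-Probability.Probability"
begin

section \<open>Complex separable Hilbert spaces\<close>

text \<open>The norm and the topology are those of the underlying real inner product space, whose
  inner product is the real part of the complex one. The complex inner product is linear in its
  first argument.\<close>

class complex_inner = real_inner +
  fixes scaleC :: "complex \<Rightarrow> 'a \<Rightarrow> 'a"  (infixr \<open>*\<^sub>C\<close> 75)
    and cinner :: "'a \<Rightarrow> 'a \<Rightarrow> complex"
  assumes scaleC_add_right: "c *\<^sub>C (x + y) = c *\<^sub>C x + c *\<^sub>C y"
    and scaleC_add_left: "(c + d) *\<^sub>C x = c *\<^sub>C x + d *\<^sub>C x"
    and scaleC_scaleC: "c *\<^sub>C d *\<^sub>C x = (c * d) *\<^sub>C x"
    and scaleC_of_real: "complex_of_real r *\<^sub>C x = r *\<^sub>R x"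
    and cinner_add_left: "cinner (x + y) z = cinner x z + cinner y z"
    and cinner_scaleC_left: "cinner (c *\<^sub>C x) y = c * cinner x y"
    and cinner_commute: "cinner x y = cnj (cinner y x)"
    and Re_cinner: "Re (cinner x y) = inner x y"

text \<open>For a metric space, second countability is separability. The zero space is allowed.\<close>

class separable_hilbert = complex_inner + complete_space + second_countable_topology

text \<open>The orthogonal direct sum of two Hilbert spaces is their product type.\<close>

instantiation prod :: (complex_inner, complex_inner) complex_inner
begin

definition scaleC_prod_def: "c *\<^sub>C p = (c *\<^sub>C fst p, c *\<^sub>C snd p)"

definition cinner_prod_def: "cinner p q = cinner (fst p) (fst q) + cinner (snd p) (snd q)"

instance
proof
  fix c d :: complex and r :: real and x y z :: "'a \<times> 'b"
  show "c *\<^sub>C (x + y) = c *\<^sub>C x + c *\<^sub>C y"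
    by (simp add: scaleC_prod_def scaleC_add_right)
  show "(c + d) *\<^sub>C x = c *\<^sub>C x + d *\<^sub>C x"
    by (simp add: scaleC_prod_def scaleC_add_left)
  show "c *\<^sub>C d *\<^sub>C x = (c * d) *\<^sub>C x"
    by (simp add: scaleC_prod_def scaleC_scaleC)
  show "complex_of_real r *\<^sub>C x = r *\<^sub>R x"
    by (simp add: scaleC_prod_def scaleC_of_real scaleR_prod_def)
  show "cinner (x + y) z = cinner x z + cinner y z"
    by (simp add: cinner_prod_def cinner_add_left)
  show "cinner (c *\<^sub>C x) y = c * cinner x y"
    by (simp add: cinner_prod_def scaleC_prod_def cinner_scaleC_left algebra_simps)
  show "cinner x y = cnj (cinner y x)"
    by (simp add: cinner_prod_def cinner_commute[symmetric])
  show "Re (cinner x y) = inner x y"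
    by (simp add: cinner_prod_def inner_prod_def Re_cinner)
qed

end

instance prod :: (separable_hilbert, separable_hilbert) separable_hilbert ..

definition bounded_clinear :: "('a::complex_inner \<Rightarrow> 'b::complex_inner) \<Rightarrow> bool" where
  "bounded_clinear T \<longleftrightarrow> bounded_linear T \<and> (\<forall>c x. T (c *\<^sub>C x) = c *\<^sub>C T x)"

definition cadjoint :: "('a::complex_inner \<Rightarrow> 'b::complex_inner) \<Rightarrow> 'b \<Rightarrow> 'a" where
  "cadjoint T y = (THE x. \<forall>z. cinner z x = cinner (T z) y)"

definition isometric :: "('a::complex_inner \<Rightarrow> 'b::complex_inner) \<Rightarrow> bool" where
  "isometric V \<longleftrightarrow> bounded_clinear V \<and> (\<forall>x. norm (V x) = norm x)"

definition unitary :: "('a::complex_inner \<Rightarrow> 'a) \<Rightarrow> bool" where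
  "unitary U \<longleftrightarrow> isometric U \<and> surj U"

definition closed_cspan :: "'a::complex_inner set \<Rightarrow> 'a set" where
  "closed_cspan A = closure (span {c *\<^sub>C x |c x. x \<in> A})"

definition zpow :: "('a \<Rightarrow> 'a) \<Rightarrow> int \<Rightarrow> 'a \<Rightarrow> 'a" where
  "zpow U k = (if k \<ge> 0 then U ^^ nat k else (inv U) ^^ nat (- k))"

section \<open>Functions on the unit circle\<close>

text \<open>Normalized Lebesgue measure on the unit circle, completed so that its measurable functions
  are the Lebesgue measurable ones.\<close>

definition circle :: "complex measure" where
  "circle = completion
     (distr (uniform_measure lborel {0..<2 * pi}) (restrict_space borel (sphere 0 1)) cis)"

text \<open>Elements of \<open>L\<^sup>2\<close> and of \<open>CM\<close> are handled through representatives; equality of classes is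
  equality almost everywhere. Values outside the unit circle are irrelevant.\<close>

definition L2 :: "(complex \<Rightarrow> 'a::separable_hilbert) set" where
  "L2 = {x \<in> borel_measurable circle. integrable circle (\<lambda>t. (norm (x t))\<^sup>2)}"

definition L2_inner :: "(complex \<Rightarrow> 'a::separable_hilbert) \<Rightarrow> (complex \<Rightarrow> 'a) \<Rightarrow> complex" where
  "L2_inner x y = (LINT t|circle. cinner (x t) (y t))"

text \<open>Operator-valued functions are measurable in the strong sense; as the spaces are separable,
  this is the same as weak measurability.\<close>

definition CM :: "(complex \<Rightarrow> 'g::separable_hilbert \<Rightarrow> 'f::separable_hilbert) set" where
  "CM = {\<theta>. (\<forall>t \<in> sphere 0 1. bounded_clinear (\<theta> t)) \<and>
            (\<forall>g. (\<lambda>t. \<theta> t g) \<in> borel_measurable circle) \<and>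
            (AE t in circle. onorm (\<theta> t) \<le> 1)}"

section \<open>Unitary couplings\<close>

text \<open>The three Hilbert spaces of a coupling are the type parameters.\<close>

record ('h, 'f, 'g) coupling =
  cpl_U :: "'h \<Rightarrow> 'h"
  cpl_VF :: "'f \<Rightarrow> 'h"
  cpl_VG :: "'g \<Rightarrow> 'h"

definition wandering :: "('h::separable_hilbert \<Rightarrow> 'h) \<Rightarrow> 'h set \<Rightarrow> bool" where
  "wandering U N \<longleftrightarrow>
     (\<forall>k m. k \<noteq> m \<longrightarrow> (\<forall>x \<in> zpow U k ` N. \<forall>y \<in> zpow U m ` N. cinner x y = 0))"

text \<open>The orthogonal sum of the subspaces \<open>U\<^sup>k N\<close>.\<close>

definition wandering_sum :: "('h::separable_hilbert \<Rightarrow> 'h) \<Rightarrow> 'h set \<Rightarrow> 'h set" where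
  "wandering_sum U N = closed_cspan (\<Union>k. zpow U k ` N)"

definition unitary_coupling ::
    "('h::separable_hilbert, 'f::separable_hilbert, 'g::separable_hilbert) coupling \<Rightarrow> bool" where
  "unitary_coupling \<sigma> \<longleftrightarrow>
     unitary (cpl_U \<sigma>) \<and> isometric (cpl_VF \<sigma>) \<and> isometric (cpl_VG \<sigma>) \<and>
     wandering (cpl_U \<sigma>) (range (cpl_VF \<sigma>)) \<and> wandering (cpl_U \<sigma>) (range (cpl_VG \<sigma>))"

definition minimal_coupling ::
    "('h::separable_hilbert, 'f::separable_hilbert, 'g::separable_hilbert) coupling \<Rightarrow> bool" where
  "minimal_coupling \<sigma> \<longleftrightarrow>
     closed_cspan (wandering_sum (cpl_U \<sigma>) (range (cpl_VF \<sigma>)) \<union>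
                   wandering_sum (cpl_U \<sigma>) (range (cpl_VG \<sigma>))) = UNIV"

text \<open>\<open>fourier_rep U V h x\<close> means that \<open>x\<close> represents the class \<open>\<Phi> h\<close> of
  \<open>\<Sum>k\<in>\<int>. t\<^sup>k V\<^sup>* U\<^bsup>-k\<^esup> h\<close>, the series being (unconditionally) convergent in \<open>L\<^sup>2\<close>.\<close>

definition fourier_rep ::
    "('h::separable_hilbert \<Rightarrow> 'h) \<Rightarrow> ('l::separable_hilbert \<Rightarrow> 'h) \<Rightarrow> 'h \<Rightarrow> (complex \<Rightarrow> 'l) \<Rightarrow> bool"
  where
  "fourier_rep U V h x \<longleftrightarrow> x \<in> L2 \<and>
     ((\<lambda>K. LINT t|circle. (norm (x t - (\<Sum>k\<in>K. (t powi k) *\<^sub>C cadjoint V (zpow U (- k) h))))\<^sup>2)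
        \<longlongrightarrow> 0) (finite_subsets_at_top UNIV)"

text \<open>The Hilbert space adjoint of \<open>\<Phi>\<close>, characterized by
  \<open>\<langle>h', \<Phi>\<^sup>* x\<rangle> = \<langle>\<Phi> h', x\<rangle>\<close> for all \<open>h'\<close>.\<close>

definition fourier_adjoint ::
    "('h::separable_hilbert \<Rightarrow> 'h) \<Rightarrow> ('l::separable_hilbert \<Rightarrow> 'h) \<Rightarrow> (complex \<Rightarrow> 'l) \<Rightarrow> 'h" where
  "fourier_adjoint U V x =
     (THE h. \<forall>h' y. fourier_rep U V h' y \<longrightarrow> cinner h' h = L2_inner y x)"

definition scattering_suboperator ::
    "('h::separable_hilbert, 'f::separable_hilbert, 'g::separable_hilbert) coupling \<Rightarrow>
     (complex \<Rightarrow> 'g \<Rightarrow> 'f) \<Rightarrow> bool" where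
  "scattering_suboperator \<sigma> \<theta> \<longleftrightarrow> \<theta> \<in> CM \<and>
     (\<forall>x \<in> L2. fourier_rep (cpl_U \<sigma>) (cpl_VF \<sigma>)
                 (fourier_adjoint (cpl_U \<sigma>) (cpl_VG \<sigma>) x) (\<lambda>t. \<theta> t (x t)))"

section \<open>Up-leftward extensions\<close>

definition block11 ::
    "(complex \<Rightarrow> 'g1 \<times> 'g::zero \<Rightarrow> 'f1 \<times> 'f) \<Rightarrow> complex \<Rightarrow> 'g1 \<Rightarrow> 'f1" where
  "block11 \<Xi> t g' = fst (\<Xi> t (g', 0))"

definition block12 ::
    "(complex \<Rightarrow> 'g1::zero \<times> 'g \<Rightarrow> 'f1 \<times> 'f) \<Rightarrow> complex \<Rightarrow> 'g \<Rightarrow> 'f1" where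
  "block12 \<Xi> t g = fst (\<Xi> t (0, g))"

definition block21 ::
    "(complex \<Rightarrow> 'g1 \<times> 'g::zero \<Rightarrow> 'f1 \<times> 'f) \<Rightarrow> complex \<Rightarrow> 'g1 \<Rightarrow> 'f" where
  "block21 \<Xi> t g' = snd (\<Xi> t (g', 0))"

definition block22 ::
    "(complex \<Rightarrow> 'g1::zero \<times> 'g \<Rightarrow> 'f1 \<times> 'f) \<Rightarrow> complex \<Rightarrow> 'g \<Rightarrow> 'f" where
  "block22 \<Xi> t g = snd (\<Xi> t (0, g))"

definition up_leftward_extension ::
    "(complex \<Rightarrow> 'g::separable_hilbert \<Rightarrow> 'f::separable_hilbert) \<Rightarrow>
     (complex \<Rightarrow> 'g1::separable_hilbert \<times> 'g \<Rightarrow> 'f1::separable_hilbert \<times> 'f) \<Rightarrow> bool" where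
  "up_leftward_extension \<theta> \<Xi> \<longleftrightarrow> \<Xi> \<in> CM \<and> (AE t in circle. block22 \<Xi> t = \<theta> t)"

definition coupling22 ::
    "('h, 'f1::zero \<times> 'f, 'g1::zero \<times> 'g) coupling \<Rightarrow> ('h, 'f, 'g) coupling" where
  "coupling22 \<tau> =
     \<lparr>cpl_U = cpl_U \<tau>, cpl_VF = (\<lambda>f. cpl_VF \<tau> (0, f)), cpl_VG = (\<lambda>g. cpl_VG \<tau> (0, g))\<rparr>"

text \<open>Regularity asks for a minimal coupling on some Hilbert space. A definition cannot quantify
  over types, so this space is a type argument: an extension is regular iff
  \<open>regular_extension TYPE('h) \<theta> \<Xi>\<close> holds for some type \<open>'h\<close>.\<close>

definition regular_extension ::
    "'h::separable_hilbert itself \<Rightarrow>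
     (complex \<Rightarrow> 'g::separable_hilbert \<Rightarrow> 'f::separable_hilbert) \<Rightarrow>
     (complex \<Rightarrow> 'g1::separable_hilbert \<times> 'g \<Rightarrow> 'f1::separable_hilbert \<times> 'f) \<Rightarrow> bool" where
  "regular_extension _ \<theta> \<Xi> \<longleftrightarrow> up_leftward_extension \<theta> \<Xi> \<and>
     (\<exists>\<tau> :: ('h, 'f1 \<times> 'f, 'g1 \<times> 'g) coupling.
        unitary_coupling \<tau> \<and> minimal_coupling \<tau> \<and> scattering_suboperator \<tau> \<Xi> \<and>
        minimal_coupling (coupling22 \<tau>))"

end

theory Submission imports Defs begin

text \<open>For a coupling with scattering suboperator \<open>\<Xi>\<close>, the function \<open>t \<mapsto> \<Xi> t g\<close> is the Fourier
  representation of \<open>V\<^sub>G g\<close>, so \<open>\<langle>U\<^sup>j V\<^sub>G g, U\<^sup>k V\<^sub>F f\<rangle>\<close> is a Fourier coefficient of \<open>\<langle>\<Xi> g, f\<rangle>\<close>. The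
  vectors \<open>U\<^sup>k V\<^sub>F (0, f)\<close> and \<open>U\<^sup>k V\<^sub>G (0, g)\<close> span the space of a regular extension, and their inner
  products among themselves and with \<open>V\<^sub>F (f', 0)\<close> and \<open>V\<^sub>G (g', 0)\<close> involve only the blocks 12, 21
  and 22. Two extensions sharing these blocks therefore have the same inner products
  \<open>\<langle>V\<^sub>G (g', 0), U\<^sup>k V\<^sub>F (f', 0)\<rangle>\<close>, that is, the same Fourier coefficients of the block 11.\<close>

section \<open>Complex inner product spaces\<close>

lemma inner_eq_cinner: "inner x y = Re (cinner x (y::'a::complex_inner))"
  by (simp add: Re_cinner)

text \<open>Since Im z = Re (-i z), the real inner products of all complex multiples of
  \<open>x\<close> recover the complex one. Hilbert space arguments can thus be carried out with the
  real inner product.\<close>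

lemma cinner_eqI:
  fixes x y :: "'a::complex_inner" and x' y' :: "'b::complex_inner"
  assumes "\<And>c. inner (c *\<^sub>C x) y = inner (c *\<^sub>C x') y'"
  shows "cinner x y = cinner x' y'"
proof (rule complex_eqI)
  show "Re (cinner x y) = Re (cinner x' y')"
    using assms[of 1] by (simp add: inner_eq_cinner cinner_scaleC_left)
  show "Im (cinner x y) = Im (cinner x' y')"
    using assms[of "-\<i>"] by (simp add: inner_eq_cinner cinner_scaleC_left)
qed

lemma inner_ext:
  fixes x y :: "'a::real_inner"
  assumes "\<And>z. inner z x = inner z y"
  shows "x = y"
  by (metis assms inner_commute inner_eq_zero_iff inner_diff_left eq_iff_diff_eq_0)

lemma cinner_zero_left [simp]: "cinner 0 y = 0"
  using cinner_add_left[of 0 0 y] by simp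

lemma scaleC_zero_right [simp]: "c *\<^sub>C (0::'a::complex_inner) = 0"
  using scaleC_add_right[of c 0 "0::'a"] by simp

lemma scaleC_one [simp]: "1 *\<^sub>C (x::'a::complex_inner) = x"
  using scaleC_of_real[of 1 x] by simp

lemma cinner_minus_left: "cinner (- x) y = - cinner x y"
  using cinner_add_left[of x "-x" y] by (simp add: add_eq_0_iff)

lemma cinner_diff_left: "cinner (x - z) y = cinner x y - cinner z y"
  using cinner_add_left[of x "-z" y] by (simp add: cinner_minus_left)

lemma cinner_zero_right [simp]: "cinner x 0 = 0"
  by (subst cinner_commute) simp

lemma cinner_diff_right: "cinner x (y - z) = cinner x y - cinner x z"
  by (subst (1 2 3) cinner_commute) (simp add: cinner_diff_left)

lemma cinner_scaleC_right: "cinner x (c *\<^sub>C y) = cnj c * cinner x y"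
  by (subst (1 2) cinner_commute) (simp add: cinner_scaleC_left)

lemma cinner_sum_left: "cinner (\<Sum>k\<in>K. f k) y = (\<Sum>k\<in>K. cinner (f k) y)"
  by (induction K rule: infinite_finite_induct) (auto simp: cinner_add_left)

lemma cinner_self: "cinner x x = complex_of_real ((norm x)\<^sup>2)"
proof (rule complex_eqI)
  show "Im (cinner x x) = Im (complex_of_real ((norm x)\<^sup>2))"
    using cinner_commute[of x x] by (metis Im_complex_of_real Reals_cnj_iff complex_is_Real_iff)
qed (simp add: Re_cinner power2_norm_eq_inner)

lemma cinner_self_eq_0 [simp]: "cinner x x = 0 \<longleftrightarrow> x = 0"
  by (simp add: cinner_self)

lemma norm_scaleC: "norm (c *\<^sub>C x) = cmod c * norm (x::'a::complex_inner)"
proof -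
  have "complex_of_real ((norm (c *\<^sub>C x))\<^sup>2) = complex_of_real ((cmod c * norm x)\<^sup>2)"
    by (simp only: cinner_self[symmetric] cinner_scaleC_left cinner_scaleC_right power_mult_distrib
        of_real_mult complex_norm_square ac_simps)
  then show ?thesis
    by (metis of_real_eq_iff norm_ge_zero mult_nonneg_nonneg power2_eq_imp_eq)
qed

lemma cmod_cinner_le: "cmod (cinner x y) \<le> norm x * norm (y::'a::complex_inner)"
proof (cases "cinner x y = 0")
  case False
  \<comment> \<open>This phase rotates the inner product onto the nonnegative real axis, where the
    real Cauchy-Schwarz inequality applies.\<close>
  define c where "c = cnj (sgn (cinner x y))"
  have c: "cmod c = 1" using False by (simp add: c_def norm_sgn)
  have "cmod (cinner x y) = Re (c * cinner x y)"
    using False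
    by (simp add: c_def sgn_eq cmod_power2[symmetric] add_divide_distrib[symmetric] flip: power2_eq_square)
      (simp add: power2_eq_square)
  also have "\<dots> = inner (c *\<^sub>C x) y" by (simp add: inner_eq_cinner cinner_scaleC_left)
  also have "\<dots> \<le> norm (c *\<^sub>C x) * norm y" by (rule norm_cauchy_schwarz)
  finally show ?thesis by (simp add: norm_scaleC c)
qed simp

lemma scaleC_scaleR: "c *\<^sub>C (r *\<^sub>R x) = r *\<^sub>R (c *\<^sub>C (x::'a::complex_inner))"
  by (simp add: scaleC_of_real[symmetric] scaleC_scaleC mult.commute)

lemma bounded_linear_scaleC: "bounded_linear (\<lambda>x::'a::complex_inner. c *\<^sub>C x)"
  by (rule bounded_linear_intro[of _ "cmod c"])
    (auto simp: scaleC_add_right scaleC_scaleR norm_scaleC mult.commute)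

text \<open>Together with \<open>cinner_conv\<close>, this reduces measurability of the complex
  operations to that of the real ones and of multiplication by \<open>\<i>\<close>.\<close>

lemma scaleC_conv: "c *\<^sub>C x = Re c *\<^sub>R x + Im c *\<^sub>R (\<i> *\<^sub>C (x::'a::complex_inner))"
proof -
  have "c *\<^sub>C x = (complex_of_real (Re c) + complex_of_real (Im c) * \<i>) *\<^sub>C x"
    using complex_eq[of c] by (simp add: mult.commute)
  then show ?thesis
    by (simp only: scaleC_add_left scaleC_of_real flip: scaleC_scaleC)
qed

lemma cinner_conv: "cinner x y = complex_of_real (inner x y) - \<i> * complex_of_real (inner (\<i> *\<^sub>C x) y)"
  by (rule complex_eqI) (simp_all add: inner_eq_cinner cinner_scaleC_left)

lemma borel_measurable_scaleC [measurable (raw)]: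
  fixes f :: "'b \<Rightarrow> 'a::separable_hilbert"
  assumes [measurable]: "c \<in> borel_measurable M" "f \<in> borel_measurable M"
  shows "(\<lambda>x. c x *\<^sub>C f x) \<in> borel_measurable M"
proof -
  have "continuous_on UNIV (\<lambda>x::'a. \<i> *\<^sub>C x)"
    by (rule linear_continuous_on[OF bounded_linear_scaleC])
  then have [measurable]: "(\<lambda>x::'a. \<i> *\<^sub>C x) \<in> borel_measurable borel"
    by (rule borel_measurable_continuous_onI)
  show ?thesis by (subst scaleC_conv) measurable
qed

lemma borel_measurable_cinner [measurable (raw)]:
  fixes f g :: "'b \<Rightarrow> 'a::separable_hilbert"
  assumes [measurable]: "f \<in> borel_measurable M" "g \<in> borel_measurable M"
  shows "(\<lambda>x. cinner (f x) (g x)) \<in> borel_measurable M"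
  by (subst cinner_conv) measurable

text \<open>Real polarization handles the real inner product, and complex linearity of
  \<open>V\<close> then gives the complex one.\<close>

lemma isometric_cinner:
  assumes "isometric V"
  shows "cinner (V x) (V y) = cinner x y"
proof (rule cinner_eqI)
  have lin: "linear V" and C: "\<And>c x. V (c *\<^sub>C x) = c *\<^sub>C V x" and n: "\<And>x. norm (V x) = norm x"
    using assms by (auto simp: isometric_def bounded_clinear_def bounded_linear.linear)
  have "inner (V x) (V y) = inner x y" for x y
    using n[of "x + y"] n[of x] n[of y]
    by (simp add: linear_add[OF lin] dot_norm)
  then show "inner (c *\<^sub>C V x) (V y) = inner (c *\<^sub>C x) y" for c
    by (metis C)
qed

section \<open>Riesz representation and adjoints\<close>

lemma riesz_real:
  fixes \<phi> :: "'a::{real_inner,complete_space} \<Rightarrow> real"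
  assumes "bounded_linear \<phi>"
  obtains x where "\<And>z. \<phi> z = inner z x"
proof -
  interpret \<phi>: bounded_linear \<phi> by fact
  \<comment> \<open>The representing vector is found as a minimizer of \<open>J\<close>: the
    functional is bounded below, the parallelogram law makes a minimizing sequence Cauchy, and the
    vanishing of the first variation at the minimum is the required identity.\<close>
  define J where "J x = (norm x)\<^sup>2 - 2 * \<phi> x" for x
  obtain B where B: "\<And>x. norm (\<phi> x) \<le> norm x * B" using \<phi>.bounded by blast
  have J_ge: "J x \<ge> - B\<^sup>2" for x
  proof -
    have "\<phi> x \<le> norm x * B" using B[of x] by auto
    moreover have "0 \<le> (norm x - B)\<^sup>2" by simp
    ultimately show ?thesis by (simp add: J_def power2_diff)
  qed
  define m where "m = Inf (range J)"
  have bdd: "bdd_below (range J)" using J_ge by (intro bdd_belowI2)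
  have m_le: "m \<le> J x" for x unfolding m_def by (rule cInf_lower[OF _ bdd]) simp
  have "\<exists>x. J x < m + 1 / Suc n" for n
    using cInf_lessD[of "range J" "m + 1 / Suc n"] by (auto simp: m_def)
  then obtain x where x: "\<And>n. J (x n) < m + 1 / Suc n" by metis
  have par: "(dist (x i) (x j))\<^sup>2 \<le> 2 / Suc i + 2 / Suc j" for i j
  proof -
    \<comment> \<open>In this parallelogram law the linear terms of \<open>J\<close> cancel. Both
      endpoint values are close to the infimum \<open>m\<close>, and the midpoint value is at least
      \<open>m\<close>.\<close>
    have "(norm (a - b))\<^sup>2 = 2 * J a + 2 * J b - 4 * J ((1/2) *\<^sub>R (a + b))" for a b
      unfolding J_def
      by (simp add: \<phi>.scaleR \<phi>.add power2_norm_eq_inner inner_simps algebra_simps inner_commute)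
    from this[of "x i" "x j"] x[of i] x[of j] m_le[of "(1/2) *\<^sub>R (x i + x j)"]
    show ?thesis by (simp add: dist_norm)
  qed
  have "Cauchy x"
  proof (rule metric_CauchyI)
    fix e :: real assume "e > 0"
    then obtain N where N: "4 / e\<^sup>2 < real (Suc N)"
      using reals_Archimedean2 by (metis less_SucI of_nat_less_iff order_less_trans)
    have "dist (x i) (x j) < e" if "i \<ge> N" "j \<ge> N" for i j
    proof -
      have "2 / real (Suc i) \<le> 2 / Suc N" "2 / real (Suc j) \<le> 2 / Suc N"
        using that by (simp_all add: frac_le)
      moreover have "4 / Suc N < e\<^sup>2" using N \<open>e > 0\<close> by (simp add: field_simps)
      ultimately have "(dist (x i) (x j))\<^sup>2 < e\<^sup>2" using par[of i j] by simp
      then show ?thesis using \<open>e > 0\<close> by (simp add: power_less_imp_less_base)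
    qed
    then show "\<exists>M. \<forall>i\<ge>M. \<forall>j\<ge>M. dist (x i) (x j) < e" by blast
  qed
  then obtain l where l: "x \<longlonglongrightarrow> l" using Cauchy_convergent_iff convergent_def by blast
  have "(\<lambda>n. J (x n)) \<longlonglongrightarrow> J l" unfolding J_def
    by (intro tendsto_intros l \<phi>.tendsto)
  moreover have "(\<lambda>n. m + 1 / Suc n) \<longlonglongrightarrow> m + 0"
    by (intro tendsto_intros LIMSEQ_Suc[OF lim_1_over_n])
  ultimately have "J l \<le> m"
    using LIMSEQ_le[of "\<lambda>n. J (x n)" "J l" "\<lambda>n. m + 1 / Suc n" m] x by (auto intro: less_imp_le)
  then have min: "J l \<le> J z" for z using m_le[of z] by simp
  have "\<phi> z = inner z l" for z
  proof -
    define d where "d = \<phi> z - inner z l"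
    have *: "J (l + t *\<^sub>R z) = J l - 2 * t * d + t\<^sup>2 * (norm z)\<^sup>2" for t
      unfolding J_def d_def power2_norm_eq_inner
      by (simp add: \<phi>.scaleR \<phi>.add inner_simps algebra_simps inner_commute power2_eq_square)
    \<comment> \<open>In the direction \<open>z\<close> the increment of \<open>J\<close> is
      smallest at \<open>t = d / (norm z)\<^sup>2\<close>. Adding \<open>1\<close> to the
      denominator keeps it positive for \<open>z = 0\<close> and still forces
      \<open>d = 0\<close>.\<close>
    define s where "s = 1 + (norm z)\<^sup>2"
    have s: "s > 0" by (simp add: s_def add_pos_nonneg)
    have "2 * (d/s) * d \<le> (d/s)\<^sup>2 * (norm z)\<^sup>2"
      using min[of "l + (d/s) *\<^sub>R z"] *[of "d/s"] by simp
    also have "\<dots> \<le> (d/s)\<^sup>2 * s" by (intro mult_left_mono) (auto simp: s_def)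
    finally have "d\<^sup>2 / s \<le> 0" using s by (simp add: power2_eq_square field_simps)
    then have "d = 0" using s by (simp add: divide_le_0_iff)
    then show ?thesis by (simp add: d_def)
  qed
  then show thesis by (rule that)
qed

text \<open>Justifies the definite description in \<open>cadjoint\<close>. Existence is the real
  Riesz representation, made complex by linearity of \<open>V\<close>; uniqueness holds because the
  inner products with all vectors determine a vector.\<close>

lemma cadjoint:
  fixes V :: "'a::separable_hilbert \<Rightarrow> 'b::complex_inner"
  assumes "bounded_clinear V"
  shows "cinner z (cadjoint V y) = cinner (V z) y"
proof -
  have V: "bounded_linear V" and C: "\<And>c x. V (c *\<^sub>C x) = c *\<^sub>C V x"
    using assms by (auto simp: bounded_clinear_def)
  have "bounded_linear (\<lambda>z. inner (V z) y)"
    by (rule bounded_linear_compose[OF bounded_linear_inner_left V])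
  then obtain x where x: "\<And>z. inner (V z) y = inner z x" using riesz_real by blast
  have "\<forall>z. cinner z x = cinner (V z) y"
    by (intro allI cinner_eqI) (metis C x)
  moreover have "x' = x" if "\<forall>z. cinner z x' = cinner (V z) y" for x'
    by (rule inner_ext) (metis that inner_eq_cinner x)
  ultimately have "\<forall>z. cinner z (cadjoint V y) = cinner (V z) y"
    unfolding cadjoint_def by (rule theI)
  then show ?thesis ..
qed

section \<open>Fourier coefficients on the unit circle\<close>

lemma space_circle [simp]: "space circle = sphere 0 1"
  by (simp add: circle_def space_restrict_space)

lemma measurable_cis_circle:
  "cis \<in> uniform_measure lborel {0..<2 * pi} \<rightarrow>\<^sub>M restrict_space borel (sphere 0 1)"
proof (rule measurable_restrict_space2)
  have "cis \<in> borel_measurable borel"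
    by (intro borel_measurable_continuous_onI continuous_intros)
  then show "cis \<in> borel_measurable (uniform_measure lborel {0..<2 * pi})"
    by simp
qed auto


lemma prob_space_circle: "prob_space circle"
proof -
  interpret P: prob_space "uniform_measure lborel {0..<2 * pi}"
    by (rule prob_space_uniform_measure) auto
  interpret D: prob_space "distr (uniform_measure lborel {0..<2 * pi}) (restrict_space borel (sphere 0 1)) cis"
    by (rule P.prob_space_distr[OF measurable_cis_circle])
  show ?thesis
    unfolding circle_def by (rule D.prob_space_completion)
qed

interpretation circle: prob_space circle
  by (rule prob_space_circle)

lemma borel_measurable_circleI:
  fixes f :: "complex \<Rightarrow> 'b::topological_space"
  assumes "f \<in> borel_measurable borel"
  shows "f \<in> borel_measurable circle"
  unfolding circle_def
  using measurable_restrict_space1[OF assms] by (intro measurable_completion) simp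

lemma measurable_circle_ident [measurable]: "(\<lambda>t. t) \<in> borel_measurable circle"
  by (rule borel_measurable_circleI) simp

lemma AE_circle_sphere: "AE t in circle. cmod t = 1"
  by (rule AE_I2) simp

lemma borel_measurable_powi [measurable]:
  "(\<lambda>t::complex. t powi k) \<in> borel_measurable borel"
  unfolding power_int_def by measurable

lemma cmod_powi_circle: "cmod t = 1 \<Longrightarrow> cmod (t powi k) = 1"
  by (simp add: norm_power_int)

text \<open>Completion does not change the integral of a Borel function. The half-open parameter
  interval is closed up by a null point to suit the fundamental theorem of calculus.\<close>

lemma integral_circle:
  fixes f :: "complex \<Rightarrow> complex"
  assumes [measurable]: "f \<in> borel_measurable borel"
  shows "(LINT t|circle. f t) = (LINT x|lborel. indicat_real {0..2*pi} x *\<^sub>R f (cis x)) / (2 * pi)"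
proof -
  have cis[measurable]: "cis \<in> borel_measurable borel"
    by (intro borel_measurable_continuous_onI continuous_intros)
  have u: "uniform_measure lborel {0..<2 * pi} = density lborel (\<lambda>x. ennreal (indicator {0..<2*pi} x / (2 * pi)))"
  proof -
    have "1 / ennreal (2 * pi) = ennreal (1 / (2 * pi))"
      using divide_ennreal[of 1 "2 * pi"] by simp
    then show ?thesis
      unfolding uniform_measure_def
      by (intro arg_cong[where f = "density lborel"] ext) (simp add: indicator_def)
  qed
  have f: "f \<in> borel_measurable (restrict_space borel (sphere 0 1))"
    by (rule measurable_restrict_space1) (rule assms)
  have fc: "(\<lambda>x. f (cis x)) \<in> borel_measurable lborel" by measurable
  have m: "(\<lambda>x. indicat_real {0..<2*pi} x / (2 * pi)) \<in> borel_measurable lborel"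
    by (intro borel_measurable_divide borel_measurable_indicator borel_measurable_const) simp
  have "(LINT t|circle. f t) = (LINT x|uniform_measure lborel {0..<2 * pi}. f (cis x))"
    unfolding circle_def
    using f integral_distr[OF measurable_cis_circle f] by (simp only: integral_completion measurable_distr_eq1)
  also have "\<dots> = (LINT x|lborel. (indicator {0..<2*pi} x / (2 * pi)) *\<^sub>R f (cis x))"
    unfolding u using m fc by (intro integral_density) auto
  also have "\<dots> = (LINT x|lborel. (indicat_real {0..2*pi} x *\<^sub>R f (cis x)) / (2 * pi))"
  proof (rule integral_cong_AE)
    have "AE x in lborel. x \<noteq> 2 * pi" by (rule AE_lborel_singleton)
    then show "AE x in lborel. (indicator {0..<2*pi} x / (2 * pi)) *\<^sub>R f (cis x)
        = (indicat_real {0..2*pi} x *\<^sub>R f (cis x)) / (2 * pi)"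
      by eventually_elim (auto simp: indicator_def scaleR_conv_of_real)
    show "(\<lambda>x. (indicator {0..<2*pi} x / (2 * pi)) *\<^sub>R f (cis x)) \<in> borel_measurable lborel"
      using m fc by (rule borel_measurable_scaleR)
    show "(\<lambda>x. (indicat_real {0..2*pi} x *\<^sub>R f (cis x)) / (2 * pi)) \<in> borel_measurable lborel"
      using fc by (intro borel_measurable_divide borel_measurable_scaleR borel_measurable_indicator borel_measurable_const) simp
  qed
  also have "\<dots> = (LINT x|lborel. indicat_real {0..2*pi} x *\<^sub>R f (cis x)) / (2 * pi)"
    by (rule integral_divide_zero)
  finally show ?thesis .
qed

lemma integral_circle_powi: "(LINT t|circle. t powi k) = (if k = 0 then 1 else 0)"
proof (cases "k = 0")
  case True
  then show ?thesis using circle.prob_space by simp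
next
  case False
  have "(LINT x|lborel. indicat_real {0..2*pi} x *\<^sub>R cis (of_int k * x)) =
    cis (of_int k * (2 * pi)) / (\<i> * of_int k) - cis (of_int k * 0) / (\<i> * of_int k)"
  proof (rule integral_FTC_Icc[where F = "\<lambda>x. cis (of_int k * x) / (\<i> * of_int k)"])
    have [simp]: "\<i> * (z * \<i>) = - z" for z by (simp add: complex_eq_iff)
    show "((\<lambda>x. cis (of_int k * x) / (\<i> * of_int k)) has_vector_derivative cis (of_int k * x))
       (at x within {0..2 * pi})" for x
      using False unfolding cis_conv_exp
      by (auto intro!: derivative_eq_intros has_vector_derivative_real_field simp: o_def)
  qed (auto intro!: continuous_intros)
  also have "of_int k * (2 * pi) = 2 * pi * of_int k" by (rule mult.commute)
  also have "cis (2 * pi * of_int k) = cis (of_int k * 0)" by (simp add: cis_multiple_2pi)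
  finally have "(LINT x|lborel. indicat_real {0..2*pi} x *\<^sub>R cis (of_int k * x)) = 0" by simp
  then show ?thesis using False integral_circle[of "\<lambda>t. t powi k"]
    by (simp add: cis_power_int borel_measurable_powi)
qed

section \<open>Uniqueness of Fourier coefficients of integrable functions\<close>

lemma le_zero_of_le_mult:
  fixes a b :: real
  assumes "\<And>e. e > 0 \<Longrightarrow> a \<le> e * b"
  shows "a \<le> 0"
proof (rule field_le_epsilon)
  fix e :: real assume "e > 0"
  then have "a \<le> e / (\<bar>b\<bar> + 1) * b" by (intro assms) (simp add: add_nonneg_pos)
  also have "e / (\<bar>b\<bar> + 1) * b \<le> e"
    using mult_left_mono[of b "\<bar>b\<bar> + 1" e] \<open>e > 0\<close>
    by (simp add: divide_le_eq add_nonneg_pos less_imp_le)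
  finally show "a \<le> 0 + e" by simp
qed

text \<open>As \<open>k\<close> runs over all integers, the property survives multiplication by
  powers of \<open>t\<close>, hence by polynomials. From there the vanishing of integrals passes to
  continuous weights and to indicators of closed and of Borel sets.\<close>

definition null_fourier :: "(complex \<Rightarrow> complex) \<Rightarrow> bool" where
  "null_fourier \<psi> \<longleftrightarrow> integrable circle \<psi> \<and> (\<forall>k. (LINT t|circle. t powi k * \<psi> t) = 0)"

lemma integrable_circle_mult:
  fixes \<psi> g :: "complex \<Rightarrow> complex"
  assumes "integrable circle \<psi>" "g \<in> borel_measurable circle" "\<And>t. cmod t = 1 \<Longrightarrow> cmod (g t) \<le> B"
  shows "integrable circle (\<lambda>t. g t * \<psi> t)"
proof (rule Bochner_Integration.integrable_bound)
  show "integrable circle (\<lambda>t. B * cmod (\<psi> t))" using assms(1) by simp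
  show "AE t in circle. norm (g t * \<psi> t) \<le> norm (B * cmod (\<psi> t))"
  proof (rule AE_I2)
    fix t assume "t \<in> space circle"
    then have "cmod (g t) \<le> B" using assms(3) by simp
    then have "cmod (g t) * cmod (\<psi> t) \<le> B * cmod (\<psi> t)" "0 \<le> B"
      by (auto intro: mult_right_mono order_trans[OF norm_ge_zero])
    then show "norm (g t * \<psi> t) \<le> norm (B * cmod (\<psi> t))" by (simp add: norm_mult)
  qed
  show "(\<lambda>t. g t * \<psi> t) \<in> borel_measurable circle"
    using assms(1,2) by (intro borel_measurable_times) auto
qed

lemma integrable_circle_powi:
  "integrable circle \<psi> \<Longrightarrow> integrable circle (\<lambda>t. t powi k * \<psi> t)"
  by (rule integrable_circle_mult[where B = 1]) (simp_all add: cmod_powi_circle)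

lemma null_fourier_powi:
  assumes "null_fourier \<psi>" shows "null_fourier (\<lambda>t. t powi j * \<psi> t)"
  unfolding null_fourier_def
proof (intro conjI allI)
  show "integrable circle (\<lambda>t. t powi j * \<psi> t)"
    using assms by (auto simp: null_fourier_def intro: integrable_circle_powi)
  fix k
  have "(LINT t|circle. t powi k * (t powi j * \<psi> t)) = (LINT t|circle. t powi (k + j) * \<psi> t)"
  proof (rule Bochner_Integration.integral_cong)
    fix t :: complex assume "t \<in> space circle"
    then have "t \<noteq> 0" by auto
    then show "t powi k * (t powi j * \<psi> t) = t powi (k + j) * \<psi> t"
      by (simp add: power_int_add)
  qed simp
  then show "(LINT t|circle. t powi k * (t powi j * \<psi> t)) = 0" using assms by (simp add: null_fourier_def)
qed

lemma null_fourier_add: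
  assumes "null_fourier \<psi>" "null_fourier \<phi>" shows "null_fourier (\<lambda>t. \<psi> t + \<phi> t)"
  using assms unfolding null_fourier_def
  by (auto simp: distrib_left Bochner_Integration.integral_add integrable_circle_powi)

lemma null_fourier_scale:
  assumes "null_fourier \<psi>" shows "null_fourier (\<lambda>t. c * \<psi> t)"
  using assms unfolding null_fourier_def by (auto simp: mult.left_commute[of _ c])

lemma null_fourier_cong:
  assumes "null_fourier \<psi>" "\<And>t. cmod t = 1 \<Longrightarrow> \<psi> t = \<phi> t"
  shows "null_fourier \<phi>"
proof -
  have "integrable circle \<phi> \<longleftrightarrow> integrable circle \<psi>"
    using assms(2) by (intro Bochner_Integration.integrable_cong) auto
  moreover have "(LINT t|circle. t powi k * \<phi> t) = (LINT t|circle. t powi k * \<psi> t)" for k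
    using assms(2) by (intro Bochner_Integration.integral_cong) auto
  ultimately show ?thesis using assms(1) by (simp add: null_fourier_def)
qed

text \<open>\<open>\<psi>\<close> varies in the induction because a product of \<open>f\<close> and
  \<open>g\<close> is treated by applying the hypothesis for \<open>f\<close> to \<open>g\<close>
  times \<open>\<psi>\<close>. On the circle a real linear \<open>f\<close> is a combination of
  \<open>t\<close> and its inverse \<open>cnj t\<close>.\<close>

lemma null_fourier_polynomial:
  assumes "real_polynomial_function g" "null_fourier \<psi>"
  shows "null_fourier (\<lambda>t. complex_of_real (g t) * \<psi> t)"
  using assms
proof (induction g arbitrary: \<psi> rule: real_polynomial_function.induct)
  case (linear f)
  \<comment> \<open>The coefficients come from \<open>f t = Re t * f 1 + Im t * f \<i>\<close> with
    \<open>Re t = (t + cnj t) / 2\<close> and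
    \<open>Im t = (t - cnj t) / (2 * \<i>)\<close>.\<close>
  define c where "c = complex_of_real (f 1) / 2"
  define d where "d = complex_of_real (f \<i>) / (2 * \<i>)"
  have N: "null_fourier (\<lambda>t. ((c + d) * (t powi 1 * \<psi> t)) + (c - d) * (t powi (-1) * \<psi> t))"
    by (intro null_fourier_add null_fourier_scale null_fourier_powi linear)
  show ?case
  proof (rule null_fourier_cong[OF N])
    fix t :: complex assume "cmod t = 1"
    then have "t * cnj t = 1" by (simp flip: complex_norm_square)
    then have "inverse t = cnj t" by (rule inverse_unique)
    then have inv: "t powi (-1) = cnj t" by (simp add: power_int_minus)
    interpret f: bounded_linear f by fact
    have "f (Re t *\<^sub>R 1 + Im t *\<^sub>R \<i>) = Re t * f 1 + Im t * f \<i>"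
      by (simp only: f.add f.scaleR real_scaleR_def)
    moreover have "Re t *\<^sub>R 1 + Im t *\<^sub>R \<i> = t" by (simp add: complex_eq_iff)
    ultimately have "f t = Re t * f 1 + Im t * f \<i>" by metis
    moreover have "(c + d) * t + (c - d) * cnj t = c * (t + cnj t) + d * (t - cnj t)"
      by (simp add: algebra_simps)
    moreover have "\<dots> = complex_of_real (Re t * f 1 + Im t * f \<i>)"
      by (simp add: complex_add_cnj complex_diff_cnj c_def d_def complex_eq_iff)
    ultimately have "complex_of_real (f t) = (c + d) * t + (c - d) * cnj t" by metis
    then show "(c + d) * (t powi 1 * \<psi> t) + (c - d) * (t powi (-1) * \<psi> t) = complex_of_real (f t) * \<psi> t"
      by (simp only: inv power_int_1_right) (simp only: distrib_right mult.assoc)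
  qed
next
  case (const c)
  then show ?case by (rule null_fourier_scale)
next
  case (add f g)
  then show ?case by (simp add: distrib_right null_fourier_add)
next
  case (mult f g)
  from mult.IH(1)[OF mult.IH(2)[OF mult.prems]] show ?case by (simp add: mult.assoc)
qed

lemma null_fourier_continuous:
  fixes f :: "complex \<Rightarrow> real"
  assumes \<psi>: "null_fourier \<psi>" and f: "continuous_on UNIV f"
  shows "(LINT t|circle. complex_of_real (f t) * \<psi> t) = 0"
proof -
  have int: "integrable circle \<psi>" using \<psi> by (simp add: null_fourier_def)
  have bdd: "integrable circle (\<lambda>t. complex_of_real (g t) * \<psi> t)" if "continuous_on UNIV g" for g
  proof -
    have "bounded (g ` sphere 0 1)"
      by (intro compact_imp_bounded compact_continuous_image continuous_on_subset[OF that]) auto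
    then obtain B where "\<And>t. cmod t = 1 \<Longrightarrow> \<bar>g t\<bar> \<le> B"
      unfolding bounded_iff by fastforce
    moreover have [measurable]: "g \<in> borel_measurable borel" using that by (rule borel_measurable_continuous_onI)
    ultimately show ?thesis by (intro integrable_circle_mult[OF int, of _ B]) auto
  qed
  have "cmod (LINT t|circle. complex_of_real (f t) * \<psi> t) \<le> e * (LINT t|circle. cmod (\<psi> t))" if "e > 0" for e
  proof -
    \<comment> \<open>Uniform approximation on the compact circle; replacing \<open>f\<close> by
      \<open>g\<close> costs at most \<open>e\<close> times the integral of the modulus of
      \<open>\<psi>\<close>.\<close>
    obtain g where g: "real_polynomial_function g" "\<And>t. t \<in> sphere 0 1 \<Longrightarrow> \<bar>f t - g t\<bar> < e"
      by (rule Stone_Weierstrass_real_polynomial_function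
          [OF compact_sphere continuous_on_subset[OF f subset_UNIV] \<open>e > 0\<close>]) blast
    have contg: "continuous_on UNIV g"
      using g(1) by (simp add: real_polynomial_function_eq continuous_on_polymonial_function)
    have "null_fourier (\<lambda>t. complex_of_real (g t) * \<psi> t)" using null_fourier_polynomial[OF g(1) \<psi>] .
    then have "(LINT t|circle. t powi 0 * (complex_of_real (g t) * \<psi> t)) = 0"
      unfolding null_fourier_def by blast
    then have "(LINT t|circle. complex_of_real (f t) * \<psi> t) =
        (LINT t|circle. complex_of_real (f t) * \<psi> t - complex_of_real (g t) * \<psi> t)"
      using bdd[OF f] bdd[OF contg] by simp
    also have "cmod \<dots> \<le> (LINT t|circle. cmod (complex_of_real (f t) * \<psi> t - complex_of_real (g t) * \<psi> t))"
      by (rule integral_norm_bound)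
    also have "\<dots> \<le> (LINT t|circle. e * cmod (\<psi> t))"
    proof (rule integral_mono)
      show "integrable circle (\<lambda>t. cmod (complex_of_real (f t) * \<psi> t - complex_of_real (g t) * \<psi> t))"
        using bdd[OF f] bdd[OF contg] by auto
      show "integrable circle (\<lambda>t. e * cmod (\<psi> t))" using int by auto
      fix t assume "t \<in> space circle"
      then have "\<bar>f t - g t\<bar> \<le> e" using g(2)[of t] by simp
      then have "\<bar>f t - g t\<bar> * cmod (\<psi> t) \<le> e * cmod (\<psi> t)" by (intro mult_right_mono) auto
      then show "cmod (complex_of_real (f t) * \<psi> t - complex_of_real (g t) * \<psi> t) \<le> e * cmod (\<psi> t)"
        by (simp add: norm_mult flip: left_diff_distrib of_real_diff)
    qed
    finally show ?thesis by simp
  qed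
  then have "cmod (LINT t|circle. complex_of_real (f t) * \<psi> t) \<le> 0"
    by (rule le_zero_of_le_mult)
  then show ?thesis by simp
qed

text \<open>The continuous cutoffs \<open>f n\<close> lie between 0 and 1 and tend pointwise to the
  indicator of \<open>C\<close>, so dominated convergence applies with the modulus of
  \<open>\<psi>\<close> as bound.\<close>

lemma null_fourier_closed:
  assumes \<psi>: "null_fourier \<psi>" and C: "closed C"
  shows "(LINT t|circle. indicat_real C t *\<^sub>R \<psi> t) = 0"
\<comment> \<open>\<open>infdist\<close> to the empty set is 0 by convention, so the cutoffs would
  be constantly 1 there instead of tending to 0.\<close>
proof (cases "C = {}")
  case False
  have int[measurable]: "integrable circle \<psi>" using \<psi> by (simp add: null_fourier_def)
  define f where "f n t = max 0 (1 - real n * infdist t C)" for n t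
  have cont: "continuous_on UNIV (f n)" for n
    unfolding f_def by (intro continuous_intros)
  have [measurable]: "f n \<in> borel_measurable borel" for n
    using cont by (rule borel_measurable_continuous_onI)
  have [measurable]: "C \<in> sets borel" using C by auto
  have lim: "(\<lambda>n. f n t) \<longlonglongrightarrow> indicat_real C t" for t
  proof (cases "t \<in> C")
    case True
    then show ?thesis by (simp add: f_def)
  next
    case False
    then have pos: "infdist t C > 0"
      using C \<open>C \<noteq> {}\<close> in_closed_iff_infdist_zero[of C t] infdist_nonneg[of t C] by auto
    then obtain N where N: "1 / infdist t C < real N" using reals_Archimedean2 by blast
    have "\<forall>\<^sub>F n in sequentially. f n t = 0"
      using eventually_ge_at_top[of N]
    proof eventually_elim
      case (elim n)
      then have "1 / infdist t C < real n" using N by simp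
      then show ?case using pos by (simp add: f_def field_simps)
    qed
    then show ?thesis using False by (simp add: tendsto_eventually)
  qed
  have "(\<lambda>n. LINT t|circle. f n t *\<^sub>R \<psi> t) \<longlonglongrightarrow> (LINT t|circle. indicat_real C t *\<^sub>R \<psi> t)"
  proof (rule integral_dominated_convergence[where w = "\<lambda>t. cmod (\<psi> t)"])
    show "AE t in circle. (\<lambda>n. f n t *\<^sub>R \<psi> t) \<longlonglongrightarrow> indicat_real C t *\<^sub>R \<psi> t"
      by (intro AE_I2 tendsto_intros lim)
    have "\<bar>f n t\<bar> \<le> 1" for n t by (auto simp: f_def infdist_nonneg)
    then show "AE t in circle. norm (f n t *\<^sub>R \<psi> t) \<le> cmod (\<psi> t)" for n
      by (intro AE_I2) (simp add: mult_left_le_one_le)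
  qed (measurable, use int in simp)
  moreover have "(LINT t|circle. f n t *\<^sub>R \<psi> t) = 0" for n
    using null_fourier_continuous[OF \<psi> cont] by (simp add: scaleR_conv_of_real)
  ultimately show ?thesis by (simp add: LIMSEQ_const_iff)
qed simp

text \<open>Dynkin argument: closed sets are stable under intersection and generate the Borel sets.
  Complements use that the whole plane is closed, disjoint unions use countable additivity of the
  integral.\<close>

lemma null_fourier_borel:
  assumes \<psi>: "null_fourier \<psi>" and A: "A \<in> sets (borel :: complex measure)"
  shows "(LINT t|circle. indicat_real A t *\<^sub>R \<psi> t) = 0"
proof -
  have int[measurable]: "integrable circle \<psi>" using \<psi> by (simp add: null_fourier_def)
  have intA: "integrable circle (\<lambda>t. indicat_real A t *\<^sub>R \<psi> t)" if [measurable]: "A \<in> sets borel" for A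
    by (intro Bochner_Integration.integrable_bound[OF int] AE_I2) (measurable, simp add: indicator_def)
  have borel: "sets (borel :: complex measure) = sigma_sets UNIV (Collect closed)"
    by (simp add: borel_eq_closed)
  have "Int_stable (Collect closed :: complex set set)" by (auto simp: Int_stable_def)
  moreover have "Collect closed \<subseteq> Pow (UNIV :: complex set)" by simp
  ultimately show ?thesis using A unfolding borel
  proof (induction rule: sigma_sets_induct_disjoint)
    case empty
    show ?case by simp
  next
    case (basic A)
    then show ?case using null_fourier_closed[OF \<psi>] by simp
  next
    case (compl A)
    have "(LINT t|circle. indicat_real (UNIV - A) t *\<^sub>R \<psi> t) =
      (LINT t|circle. indicat_real UNIV t *\<^sub>R \<psi> t - indicat_real A t *\<^sub>R \<psi> t)"
      by (intro Bochner_Integration.integral_cong) (auto simp: indicator_def)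
    also have "\<dots> = 0"
      using compl null_fourier_closed[OF \<psi> closed_UNIV] intA[of A] intA[of UNIV]
      by (subst Bochner_Integration.integral_diff) (auto simp: borel)
    finally show ?case .
  next
    case (union A)
    then have A: "A i \<in> sets borel" for i by (auto simp: borel)
    \<comment> \<open>The sets \<open>A i\<close> live in the plane, whereas measurable sets of
      \<open>circle\<close> lie on the sphere; intersecting with the sphere leaves the integrals
      unchanged.\<close>
    have S: "B \<inter> sphere 0 1 \<in> sets circle" if "B \<in> sets borel" for B
      unfolding circle_def using that
      by (intro sets_completionI_sets) (auto simp: sets_restrict_space)
    have I: "(LINT t:(B \<inter> sphere 0 1)|circle. \<psi> t) = (LINT t|circle. indicat_real B t *\<^sub>R \<psi> t)" for B
      unfolding set_lebesgue_integral_def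
      by (intro Bochner_Integration.integral_cong) (auto simp: indicator_def)
    have "(LINT t:(\<Union>i. A i \<inter> sphere 0 1)|circle. \<psi> t) = (\<Sum>i. LINT t:(A i \<inter> sphere 0 1)|circle. \<psi> t)"
    proof (rule lebesgue_integral_countable_add)
      show "A i \<inter> sphere 0 1 \<in> sets circle" for i using A by (rule S)
      show "A i \<inter> sphere 0 1 \<inter> (A j \<inter> sphere 0 1) = {}" if "i \<noteq> j" for i j
        using union(1) that by (auto simp: disjoint_family_on_def)
      show "set_integrable circle (\<Union>i. A i \<inter> sphere 0 1) \<psi>"
        unfolding set_integrable_def using A S by (intro integrable_mult_indicator int sets.countable_UN) auto
    qed
    moreover have "(\<Union>i. A i \<inter> sphere 0 1) = (\<Union>i. A i) \<inter> sphere 0 1" by auto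
    ultimately show ?case using union by (simp add: I)
  qed
qed

text \<open>An integrable function whose integral over every measurable set is zero vanishes a.e.
  Since \<open>circle\<close> is a completion, each such set is a Borel set up to part of a null
  set, which reduces the claim to \<open>null_fourier_borel\<close>.\<close>

lemma null_fourier_AE:
  assumes \<psi>: "null_fourier \<psi>"
  shows "AE t in circle. \<psi> t = 0"
proof (rule circle.density_zero)
  show int[measurable]: "integrable circle \<psi>" using \<psi> by (simp add: null_fourier_def)
  fix A assume A[measurable]: "A \<in> sets circle"
  let ?M = "distr (uniform_measure lborel {0..<2 * pi}) (restrict_space borel (sphere 0 1)) cis"
  obtain S N N' where A_eq: "A = S \<union> N" and N: "N \<subseteq> N'" "N' \<in> null_sets ?M" and S: "S \<in> sets ?M"
    using A unfolding circle_def by (rule sets_completionE)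
  have B: "S \<in> sets borel"
    using S by (auto simp: sets_restrict_space)
  have "AE t in circle. t \<notin> N'"
    unfolding circle_def by (intro AE_completion AE_not_in N)
  then have "AE t in circle. indicat_real A t *\<^sub>R \<psi> t = indicat_real S t *\<^sub>R \<psi> t"
    by eventually_elim (use A_eq N(1) in \<open>auto simp: indicator_def\<close>)
  moreover have "(\<lambda>t. indicat_real A t *\<^sub>R \<psi> t) \<in> borel_measurable circle" by measurable
  moreover have "(\<lambda>t. indicat_real S t *\<^sub>R \<psi> t) \<in> borel_measurable circle"
    using B by measurable
  ultimately have "set_lebesgue_integral circle A \<psi> = (LINT t|circle. indicat_real S t *\<^sub>R \<psi> t)"
    unfolding set_lebesgue_integral_def by (intro integral_cong_AE)
  then show "set_lebesgue_integral circle A \<psi> = 0"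
    using null_fourier_borel[OF \<psi> B] by simp
qed

section \<open>The Fourier representation of a coupling\<close>

lemma L2_measurable: "x \<in> L2 \<Longrightarrow> x \<in> borel_measurable circle"
  and L2_integrable: "x \<in> L2 \<Longrightarrow> integrable circle (\<lambda>t. (norm (x t))\<^sup>2)"
  by (auto simp: L2_def)

lemma L2_bounded:
  assumes [measurable]: "x \<in> borel_measurable circle" and b: "\<And>t. cmod t = 1 \<Longrightarrow> norm (x t) \<le> B"
  shows "x \<in> L2"
proof -
  have "integrable circle (\<lambda>t. (norm (x t))\<^sup>2)"
    by (rule circle.integrable_const_bound[where B = "B\<^sup>2"]) (auto simp: b power_mono)
  then show ?thesis by (simp add: L2_def)
qed

lemma L2_diff:
  assumes x: "x \<in> L2" and y: "y \<in> L2"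
  shows "(\<lambda>t. x t - y t) \<in> L2"
proof -
  note [measurable] = L2_measurable[OF x] L2_measurable[OF y]
  have "integrable circle (\<lambda>t. (norm (x t - y t))\<^sup>2)"
  proof (rule Bochner_Integration.integrable_bound)
    show "integrable circle (\<lambda>t. 2 * (norm (x t))\<^sup>2 + 2 * (norm (y t))\<^sup>2)"
      using L2_integrable[OF x] L2_integrable[OF y] by simp
    have "(norm (a - b))\<^sup>2 \<le> 2 * (norm a)\<^sup>2 + 2 * (norm b)\<^sup>2" for a b :: 'a
    proof -
      have "(norm (a - b))\<^sup>2 + (norm (a + b))\<^sup>2 = 2 * (norm a)\<^sup>2 + 2 * (norm b)\<^sup>2"
        by (simp add: power2_norm_eq_inner inner_simps)
      then show ?thesis by (smt (verit) zero_le_power2)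
    qed
    then show "AE t in circle. norm ((norm (x t - y t))\<^sup>2) \<le> norm (2 * (norm (x t))\<^sup>2 + 2 * (norm (y t))\<^sup>2)"
      by (intro AE_I2) simp
  qed measurable
  then show ?thesis by (simp add: L2_def)
qed

lemma L2_norm_integrable:
  assumes x: "x \<in> L2" shows "integrable circle (\<lambda>t. norm (x t))"
proof (rule Bochner_Integration.integrable_bound)
  note [measurable] = L2_measurable[OF x]
  show "(\<lambda>t. norm (x t)) \<in> borel_measurable circle" by measurable
  show "integrable circle (\<lambda>t. 1 + (norm (x t))\<^sup>2)" using L2_integrable[OF x] by simp
  have "a \<le> 1 + a\<^sup>2" for a :: real
    using zero_le_power2[of "a - 1"] zero_le_power2[of "a + 1"] by (simp add: power2_eq_square algebra_simps)
  then show "AE t in circle. norm (norm (x t)) \<le> norm (1 + (norm (x t))\<^sup>2)"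
    by (intro AE_I2) (simp add: abs_of_nonneg add_nonneg_nonneg)
qed

text \<open>This is Cauchy-Schwarz against the constant 1 on a probability space, in the form that a
  variance is nonnegative.\<close>

lemma L2_norm_le:
  assumes x: "x \<in> L2"
  shows "(LINT t|circle. norm (x t)) \<le> sqrt (LINT t|circle. (norm (x t))\<^sup>2)"
proof -
  have "0 \<le> circle.variance (\<lambda>t. norm (x t))" by (rule circle.variance_positive)
  then have "(LINT t|circle. norm (x t))\<^sup>2 \<le> (LINT t|circle. (norm (x t))\<^sup>2)"
    using circle.variance_eq[OF L2_norm_integrable[OF x] L2_integrable[OF x]] by simp
  then show ?thesis by (rule real_le_rsqrt)
qed

lemma cnj_powi_circle: "cmod t = 1 \<Longrightarrow> cnj (t powi k) = t powi (- k)"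
proof -
  assume "cmod t = 1"
  then have "t powi k * cnj (t powi k) = 1"
    by (simp only: complex_norm_square[symmetric] cmod_powi_circle) simp
  then have "inverse (t powi k) = cnj (t powi k)" by (rule inverse_unique)
  then show ?thesis by (simp only: power_int_minus)
qed

lemma L2_cinner_integrable:
  assumes x: "x \<in> L2"
  shows "integrable circle (\<lambda>t. cinner (x t) (t powi k *\<^sub>C l))"
proof (rule Bochner_Integration.integrable_bound)
  note [measurable] = L2_measurable[OF x]
  show "(\<lambda>t. cinner (x t) (t powi k *\<^sub>C l)) \<in> borel_measurable circle" by measurable
  show "integrable circle (\<lambda>t. norm (x t) * norm l)" using L2_norm_integrable[OF x] by simp
  show "AE t in circle. norm (cinner (x t) (t powi k *\<^sub>C l)) \<le> norm (norm (x t) * norm l)"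
  proof (rule AE_I2)
    fix t assume "t \<in> space circle"
    then show "norm (cinner (x t) (t powi k *\<^sub>C l)) \<le> norm (norm (x t) * norm l)"
      using cmod_cinner_le[of "x t" "t powi k *\<^sub>C l"] by (simp add: norm_scaleC cmod_powi_circle)
  qed
qed

lemma integral_trigonometric_coeff:
  assumes "finite K" "k \<in> K"
  shows "(LINT t|circle. cinner (\<Sum>j\<in>K. t powi j *\<^sub>C c j) (t powi k *\<^sub>C l)) = cinner (c k) l"
proof -
  have int: "integrable circle (\<lambda>t. t powi (j - k) * cinner (c j) l)" for j
    using integrable_circle_powi[of "\<lambda>_. 1" "j - k"] by simp
  have "(LINT t|circle. cinner (\<Sum>j\<in>K. t powi j *\<^sub>C c j) (t powi k *\<^sub>C l)) =
     (LINT t|circle. (\<Sum>j\<in>K. t powi (j - k) * cinner (c j) l))"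
  proof (rule Bochner_Integration.integral_cong)
    fix t assume "t \<in> space circle"
    then have t: "cmod t = 1" "t \<noteq> 0" by auto
    then have "t powi (- k) * t powi j = t powi (j - k)" for j
      by (simp flip: power_int_add)
    with t show "cinner (\<Sum>j\<in>K. t powi j *\<^sub>C c j) (t powi k *\<^sub>C l) = (\<Sum>j\<in>K. t powi (j - k) * cinner (c j) l)"
      by (simp add: cinner_sum_left cinner_scaleC_left cinner_scaleC_right cnj_powi_circle[OF t(1)]
          sum_distrib_left del: complex_cnj_power_int flip: mult.assoc)
  qed simp
  also have "\<dots> = (\<Sum>j\<in>K. (LINT t|circle. t powi (j - k) * cinner (c j) l))"
    using int by (rule Bochner_Integration.integral_sum)
  also have "\<dots> = (\<Sum>j\<in>K. if j = k then cinner (c k) l else 0)"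
    by (intro sum.cong) (auto simp: integral_circle_powi)
  also have "\<dots> = cinner (c k) l" using assms by simp
  finally show ?thesis .
qed

lemma trigonometric_L2:
  assumes "finite K"
  shows "(\<lambda>t. \<Sum>j\<in>K. t powi j *\<^sub>C (c j :: 'a::separable_hilbert)) \<in> L2"
proof (rule L2_bounded[where B = "\<Sum>j\<in>K. norm (c j)"])
  show "(\<lambda>t. \<Sum>j\<in>K. t powi j *\<^sub>C c j) \<in> borel_measurable circle" by measurable
  fix t :: complex assume "cmod t = 1"
  then show "norm (\<Sum>j\<in>K. t powi j *\<^sub>C c j) \<le> (\<Sum>j\<in>K. norm (c j))"
    using norm_sum[of "\<lambda>j. t powi j *\<^sub>C c j" K] by (simp add: norm_scaleC cmod_powi_circle)
qed

lemma cadjoint_left: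
  fixes V :: "'a::separable_hilbert \<Rightarrow> 'b::complex_inner"
  assumes "bounded_clinear V"
  shows "cinner (cadjoint V y) z = cinner y (V z)"
  by (subst (1 2) cinner_commute) (simp add: cadjoint[OF assms])

text \<open>Every partial sum over a finite \<open>K\<close> containing \<open>k\<close> already has
  the coefficient \<open>c k\<close>, by orthogonality of the powers of \<open>t\<close>. Pairing
  with a fixed \<open>t powi k *\<^sub>C l\<close> is controlled by the \<open>L2\<close> distance,
  so the limit \<open>y\<close> has the same coefficient.\<close>

lemma fourier_rep_coeff:
  fixes V :: "'l::separable_hilbert \<Rightarrow> 'h::separable_hilbert"
  assumes V: "bounded_clinear V" and rep: "fourier_rep U V h y"
  shows "(LINT t|circle. cinner (y t) (t powi k *\<^sub>C l)) = cinner (zpow U (- k) h) (V l)"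
proof -
  define c where "c j = cadjoint V (zpow U (- j) h)" for j
  define S where "S K t = (\<Sum>j\<in>K. t powi j *\<^sub>C c j)" for K t
  have y: "y \<in> L2"
    and lim: "((\<lambda>K. LINT t|circle. (norm (y t - S K t))\<^sup>2) \<longlongrightarrow> 0) (finite_subsets_at_top UNIV)"
    using rep by (auto simp: fourier_rep_def S_def c_def)
  define E where "E K = sqrt (LINT t|circle. (norm (y t - S K t))\<^sup>2) * norm l" for K
  have "(E \<longlongrightarrow> sqrt 0 * norm l) (finite_subsets_at_top UNIV)"
    unfolding E_def by (intro tendsto_intros lim)
  then have "(E \<longlongrightarrow> 0) (finite_subsets_at_top UNIV)" by simp
  moreover have "\<forall>\<^sub>F K in finite_subsets_at_top UNIV.
    cmod ((LINT t|circle. cinner (y t) (t powi k *\<^sub>C l)) - cinner (c k) l) \<le> E K"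
    unfolding eventually_finite_subsets_at_top
  proof (intro exI[of _ "{k}"] conjI allI impI)
    fix K assume "finite K \<and> {k} \<subseteq> K \<and> K \<subseteq> UNIV"
    then have K: "finite K" "k \<in> K" by auto
    have S: "S K \<in> L2" unfolding S_def[abs_def] by (rule trigonometric_L2[OF K(1)])
    have d: "(\<lambda>t. y t - S K t) \<in> L2" by (rule L2_diff[OF y S])
    have "(LINT t|circle. cinner (y t) (t powi k *\<^sub>C l)) - cinner (c k) l =
      (LINT t|circle. cinner (y t) (t powi k *\<^sub>C l)) - (LINT t|circle. cinner (S K t) (t powi k *\<^sub>C l))"
      using integral_trigonometric_coeff[OF K, of c l] by (simp add: S_def)
    also have "\<dots> = (LINT t|circle. cinner (y t - S K t) (t powi k *\<^sub>C l))"
      using L2_cinner_integrable[OF y] L2_cinner_integrable[OF S] by (simp add: cinner_diff_left)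
    also have "cmod \<dots> \<le> (LINT t|circle. cmod (cinner (y t - S K t) (t powi k *\<^sub>C l)))"
      by (rule integral_norm_bound)
    also have "\<dots> \<le> (LINT t|circle. norm (y t - S K t) * norm l)"
    proof (rule integral_mono)
      show "integrable circle (\<lambda>t. cmod (cinner (y t - S K t) (t powi k *\<^sub>C l)))"
        using L2_cinner_integrable[OF d] by (rule integrable_norm)
      show "integrable circle (\<lambda>t. norm (y t - S K t) * norm l)"
        using L2_norm_integrable[OF d] by simp
      fix t assume "t \<in> space circle"
      then show "cmod (cinner (y t - S K t) (t powi k *\<^sub>C l)) \<le> norm (y t - S K t) * norm l"
        using cmod_cinner_le[of "y t - S K t" "t powi k *\<^sub>C l"] by (simp add: norm_scaleC cmod_powi_circle)
    qed
    also have "\<dots> = (LINT t|circle. norm (y t - S K t)) * norm l" by simp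
    also have "\<dots> \<le> E K"
      unfolding E_def by (intro mult_right_mono L2_norm_le[OF d]) simp
    finally show "cmod ((LINT t|circle. cinner (y t) (t powi k *\<^sub>C l)) - cinner (c k) l) \<le> E K" .
  qed simp_all
  ultimately have "cmod ((LINT t|circle. cinner (y t) (t powi k *\<^sub>C l)) - cinner (c k) l) \<le> 0"
    by (intro tendsto_lowerbound[where F = "finite_subsets_at_top UNIV"]) auto
  then show ?thesis by (simp add: c_def cadjoint_left[OF V])
qed

section \<open>Integer powers of a unitary operator\<close>

lemma zpow_0 [simp]: "zpow U 0 x = x"
  by (simp add: zpow_def)

lemma zpow_plus_1:
  assumes "bij U"
  shows "zpow U (k + 1) x = U (zpow U k x)"
proof (cases "k \<ge> 0")
  case True
  then have "nat (k + 1) = Suc (nat k)" by simp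
  with True show ?thesis by (simp add: zpow_def)
next
  case False
  then obtain m where m: "nat (- k) = Suc m" by (metis Suc_pred' neg_0_less_iff_less not_le zero_less_nat_eq)
  then have k: "k = - int (Suc m)" using False by linarith
  have "U (zpow U k x) = (inv U ^^ m) x"
    using False m assms by (simp add: zpow_def bij_is_surj surj_f_inv_f)
  \<comment> \<open>For \<open>m = 0\<close> the exponent \<open>k + 1\<close> is 0 and falls into
    the nonnegative branch of \<open>zpow\<close>, hence the case split.\<close>
  also have "\<dots> = zpow U (k + 1) x"
    using k by (cases m) (simp_all add: zpow_def nat_add_distrib)
  finally show ?thesis by simp
qed

lemma zpow_add:
  assumes "bij U"
  shows "zpow U (j + k) x = zpow U j (zpow U k x)"
proof (induction j rule: int_induct[of _ 0])
  case (step1 i)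
  then show ?case using zpow_plus_1[OF assms, of "i + k" x] zpow_plus_1[OF assms, of i]
    by (simp add: algebra_simps)
next
  case (step2 i)
  \<comment> \<open>In the descending step the two sides are compared after one application of
    \<open>U\<close>, which is then cancelled by injectivity.\<close>
  have "U (zpow U (i - 1 + k) x) = U (zpow U (i - 1) (zpow U k x))"
    using step2 zpow_plus_1[OF assms, of "i - 1 + k" x] zpow_plus_1[OF assms, of "i - 1"]
    by (simp add: algebra_simps)
  then show ?case using bij_is_inj[OF assms] by (simp add: inj_eq)
qed simp

lemma unitary_bij: "unitary U \<Longrightarrow> bij U"
proof -
  assume U: "unitary U"
  have "inj U"
  proof (rule injI)
    fix x y assume "U x = U y"
    have "bounded_linear U" "norm (U (x - y)) = norm (x - y)"
      using U by (auto simp: unitary_def isometric_def bounded_clinear_def)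
    with \<open>U x = U y\<close> show "x = y"
      using linear_diff[OF bounded_linear.linear, of U x y] by simp
  qed
  with U show ?thesis by (simp add: unitary_def bij_def)
qed

lemma unitary_isometric: "unitary U \<Longrightarrow> isometric U"
  by (simp add: unitary_def)

lemma cinner_zpow:
  assumes "unitary U"
  shows "cinner (zpow U k x) (zpow U k y) = cinner x y"
proof (induction k rule: int_induct[of _ 0])
  case (step1 i)
  then show ?case
    by (simp add: zpow_plus_1[OF unitary_bij[OF assms]] isometric_cinner[OF unitary_isometric[OF assms]])
next
  case (step2 i)
  have "zpow U i z = U (zpow U (i - 1) z)" for z
    using zpow_plus_1[OF unitary_bij[OF assms], of "i - 1" z] by simp
  with step2 show ?case
    by (simp add: isometric_cinner[OF unitary_isometric[OF assms]])
qed simp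

lemma cinner_zpow_zpow:
  assumes "unitary U"
  shows "cinner (zpow U j x) (zpow U k y) = cinner (zpow U (j - k) x) y"
  using zpow_add[OF unitary_bij[OF assms], of k "j - k" x] cinner_zpow[OF assms, of k] by simp

section \<open>Wandering subspaces and the adjoint of the Fourier representation\<close>

lemma cinner_wandering:
  assumes "unitary U" "isometric V" "wandering U (range V)"
  shows "cinner (zpow U j (V x)) (zpow U k (V y)) = (if j = k then cinner x y else 0)"
  using assms by (auto simp: cinner_zpow isometric_cinner wandering_def)

lemma cadjoint_eqI:
  fixes V :: "'a::separable_hilbert \<Rightarrow> 'b::complex_inner"
  assumes "bounded_clinear V" "\<And>z. cinner (V z) y = cinner z x"
  shows "cadjoint V y = x"
  by (rule inner_ext) (simp add: inner_eq_cinner cadjoint[OF assms(1)] assms(2))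

text \<open>By the wandering property only the term of index \<open>k\<close> in the series is
  nonzero, so the error vanishes as soon as the finite index set contains \<open>k\<close>.\<close>

lemma fourier_rep_wandering:
  assumes U: "unitary U" and V: "isometric V" "wandering U (range V)"
  shows "fourier_rep U V (zpow U k (V l)) (\<lambda>t. t powi k *\<^sub>C l)"
  unfolding fourier_rep_def
proof
  have Vl: "bounded_clinear V" using V by (simp add: isometric_def)
  have c: "cadjoint V (zpow U (- j) (zpow U k (V l))) = (if j = k then l else 0)" for j
  proof (rule cadjoint_eqI[OF Vl])
    fix z
    have "zpow U (- j) (zpow U k (V l)) = zpow U (k - j) (V l)"
      using zpow_add[OF unitary_bij[OF U], of "- j" k "V l"] by simp
    then show "cinner (V z) (zpow U (- j) (zpow U k (V l))) = cinner z (if j = k then l else 0)"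
      using cinner_wandering[OF U V, of 0 z "k - j" l] by auto
  qed
  show "(\<lambda>t. t powi k *\<^sub>C l) \<in> L2"
    using trigonometric_L2[of "{k}" "\<lambda>_. l"] by simp
  have "\<forall>\<^sub>F K in finite_subsets_at_top UNIV. (LINT t|circle. (norm (t powi k *\<^sub>C l -
     (\<Sum>j\<in>K. t powi j *\<^sub>C cadjoint V (zpow U (- j) (zpow U k (V l))))))\<^sup>2) = 0"
    unfolding eventually_finite_subsets_at_top
  proof (intro exI[of _ "{k}"] conjI allI impI)
    fix K assume "finite K \<and> {k} \<subseteq> K \<and> K \<subseteq> UNIV"
    then have "(\<Sum>j\<in>K. t powi j *\<^sub>C (if j = k then l else 0)) = t powi k *\<^sub>C l" for t
      by (simp add: if_distrib[of "scaleC _"] cong: if_cong)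
    then show "(LINT t|circle. (norm (t powi k *\<^sub>C l -
     (\<Sum>j\<in>K. t powi j *\<^sub>C cadjoint V (zpow U (- j) (zpow U k (V l))))))\<^sup>2) = 0"
      by (simp add: c)
  qed simp_all
  then show "((\<lambda>K. LINT t|circle. (norm (t powi k *\<^sub>C l -
     (\<Sum>j\<in>K. t powi j *\<^sub>C cadjoint V (zpow U (- j) (zpow U k (V l))))))\<^sup>2) \<longlongrightarrow> 0)
     (finite_subsets_at_top UNIV)"
    by (rule tendsto_eventually)
qed

lemma fourier_rep_orthogonal:
  fixes V :: "'l::separable_hilbert \<Rightarrow> 'h::separable_hilbert"
  assumes U: "unitary U" and V: "bounded_clinear V"
    and orth: "\<And>k l. cinner (zpow U k (V l)) d = 0"
  shows "fourier_rep U V d (\<lambda>_. 0)"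
proof -
  have "cadjoint V (zpow U (- j) d) = 0" for j
  proof (rule cadjoint_eqI[OF V])
    fix z
    show "cinner (V z) (zpow U (- j) d) = cinner z 0"
      using cinner_zpow_zpow[OF U, of 0 "V z" "- j" d] orth by simp
  qed
  moreover have "(\<lambda>_. 0 :: 'l) \<in> L2" by (rule L2_bounded[where B = 0]) auto
  ultimately show ?thesis by (simp add: fourier_rep_def)
qed

text \<open>Uniqueness in the definition of the adjoint does not need a Fourier representation of every
  vector: a difference \<open>d\<close> of two candidates annihilates all \<open>U\<^sup>k V l\<close>, so that \<open>d\<close> itself is
  represented by \<open>0\<close> and hence annihilates itself.\<close>

lemma fourier_adjoint_const:
  assumes U: "unitary U" and V: "isometric V" "wandering U (range V)"
  shows "fourier_adjoint U V (\<lambda>_. l) = V l"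
  unfolding fourier_adjoint_def
proof (rule the_equality)
  have Vl: "bounded_clinear V" using V by (simp add: isometric_def)
  show V_eq: "\<forall>h' y. fourier_rep U V h' y \<longrightarrow> cinner h' (V l) = L2_inner y (\<lambda>_. l)"
    using fourier_rep_coeff[OF Vl, of U _ _ 0 l] by (auto simp: L2_inner_def)
  fix h
  assume h: "\<forall>h' y. fourier_rep U V h' y \<longrightarrow> cinner h' h = L2_inner y (\<lambda>_. l)"
  define d where "d = h - V l"
  have d: "cinner h' d = 0" if "fourier_rep U V h' y" for h' y
    using h V_eq that by (simp add: d_def cinner_diff_right)
  have "fourier_rep U V d (\<lambda>_. 0)"
    by (rule fourier_rep_orthogonal[OF U Vl d[OF fourier_rep_wandering[OF U V]]])
  from d[OF this] show "h = V l" by (simp add: d_def)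
qed

lemma cinner_coupling:
  assumes \<sigma>: "unitary_coupling \<sigma>" "scattering_suboperator \<sigma> \<Theta>"
  shows "cinner (zpow (cpl_U \<sigma>) j (cpl_VG \<sigma> g)) (zpow (cpl_U \<sigma>) k (cpl_VF \<sigma> f)) =
    (LINT t|circle. cinner (\<Theta> t g) (t powi (k - j) *\<^sub>C f))"
proof -
  have U: "unitary (cpl_U \<sigma>)" and VF: "bounded_clinear (cpl_VF \<sigma>)"
    and VG: "isometric (cpl_VG \<sigma>)" "wandering (cpl_U \<sigma>) (range (cpl_VG \<sigma>))"
    using \<sigma>(1) by (auto simp: unitary_coupling_def isometric_def)
  have "(\<lambda>_. g) \<in> L2" by (rule L2_bounded[where B = "norm g"]) auto
  then have "fourier_rep (cpl_U \<sigma>) (cpl_VF \<sigma>) (cpl_VG \<sigma> g) (\<lambda>t. \<Theta> t g)"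
    using \<sigma>(2) fourier_adjoint_const[OF U VG, of g] by (auto simp: scattering_suboperator_def)
  \<comment> \<open>The coefficient of index \<open>n\<close> pairs the power \<open>- n\<close> of
    \<open>U\<close> with \<open>V\<^sub>F f\<close>. Moving the \<open>k\<close>-th power to the
    left leaves the exponent \<open>j - k\<close>, so \<open>n = k - j\<close>.\<close>
  from fourier_rep_coeff[OF VF this, of "k - j" f] show ?thesis
    by (simp add: cinner_zpow_zpow[OF U])
qed

section \<open>Corresponding vectors of two couplings\<close>

text \<open>The pairs of \<open>R\<close> are corresponding vectors in two spaces. Approximating \<open>v\<close> by the first
  component of some \<open>p\<close> in the span of \<open>R\<close> approximates \<open>v'\<close> by the second one equally well, since
  the norms of the errors are computed from the same inner products.\<close>

lemma inner_eq_of_gram_eq: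
  fixes R :: "('a::real_inner \<times> 'b::real_inner) set"
  assumes gram: "\<And>p q. p \<in> R \<Longrightarrow> q \<in> R \<Longrightarrow> inner (fst p) (fst q) = inner (snd p) (snd q)"
    and dense: "closure (span (fst ` R)) = UNIV"
    and v: "\<And>p. p \<in> R \<Longrightarrow> inner (fst p) v = inner (snd p) v'" and norm_v: "norm v = norm v'"
    and w: "\<And>p. p \<in> R \<Longrightarrow> inner (fst p) w = inner (snd p) w'"
  shows "inner v w = inner v' w'"
proof -
  \<comment> \<open>The span is taken in the product space, so both components of \<open>p\<close>
    are combinations with the same coefficients and agreement on \<open>R\<close> extends
    linearly.\<close>
  have ext: "inner (fst p) x = inner (snd p) x'"
    if "\<And>p. p \<in> R \<Longrightarrow> inner (fst p) x = inner (snd p) x'" "p \<in> span R" for p x x'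
    using that(2) by (induction rule: span_induct_alt) (simp_all add: inner_simps that(1))
  have gram_span: "inner (fst p) (fst q) = inner (snd p) (snd q)" if "p \<in> span R" "q \<in> span R" for p q
    using that(1)
    by (rule ext[rotated]) (subst (1 2) inner_commute, rule ext[OF _ that(2)], simp add: gram)
  have "\<bar>inner v w - inner v' w'\<bar> \<le> e * (norm w + norm w')" if "e > 0" for e
  proof -
    have "v \<in> closure (fst ` span R)"
      using dense by (simp add: linear_span_image linear_fst)
    then obtain p where p: "p \<in> span R" "norm (v - fst p) < e"
      using \<open>e > 0\<close> by (auto simp: closure_approachable dist_norm norm_minus_commute)
    \<comment> \<open>Expanding the squares leaves the norms of \<open>v\<close> and
      \<open>fst p\<close> and their inner product, each equal to its counterpart; this transfers
      the approximation to the second space.\<close>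
    have "(norm (v - fst p))\<^sup>2 = (norm (v' - snd p))\<^sup>2"
      using ext[of v v', OF v p(1)] gram_span[OF p(1) p(1)] norm_v
      by (simp add: power2_norm_eq_inner norm_eq_sqrt_inner inner_diff inner_commute)
    then have q: "norm (v' - snd p) < e" using p(2) by simp
    \<comment> \<open>The terms pairing \<open>p\<close> with \<open>w\<close> and \<open>w'\<close>
      coincide and cancel, so only the two approximation errors remain.\<close>
    have "inner v w - inner v' w' = inner (v - fst p) w - inner (v' - snd p) w'"
      using ext[of w w', OF w p(1)] by (simp add: inner_diff_left)
    also have "\<bar>\<dots>\<bar> \<le> norm (v - fst p) * norm w + norm (v' - snd p) * norm w'"
      using Cauchy_Schwarz_ineq2[of "v - fst p" w] Cauchy_Schwarz_ineq2[of "v' - snd p" w'] by linarith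
    also have "\<dots> \<le> e * norm w + e * norm w'"
      using p(2) q by (intro add_mono mult_right_mono) auto
    finally show ?thesis by (simp add: distrib_left)
  qed
  then have "\<bar>inner v w - inner v' w'\<bar> \<le> 0" by (rule le_zero_of_le_mult)
  then show ?thesis by simp
qed

section \<open>Closed complex spans and minimality\<close>

lemma subspace_closure:
  fixes S :: "'a::real_normed_vector set"
  assumes S: "subspace S" shows "subspace (closure S)"
proof (rule subspaceI)
  show "0 \<in> closure S" using subspace_0[OF S] closure_subset by blast
  show "x + y \<in> closure S" if xy: "x \<in> closure S" "y \<in> closure S" for x y
  proof -
    obtain f g where "\<And>n. f n \<in> S" "f \<longlonglongrightarrow> x" "\<And>n. g n \<in> S" "g \<longlonglongrightarrow> y"
      using xy unfolding closure_sequential by blast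
    then show ?thesis
      unfolding closure_sequential
      by (intro exI[of _ "\<lambda>n. f n + g n"]) (simp add: subspace_add[OF S] tendsto_add)
  qed
  show "c *\<^sub>R x \<in> closure S" if x: "x \<in> closure S" for c x
  proof -
    obtain f where "\<And>n. f n \<in> S" "f \<longlonglongrightarrow> x"
      using x unfolding closure_sequential by blast
    then show ?thesis
      unfolding closure_sequential
      by (intro exI[of _ "\<lambda>n. c *\<^sub>R f n"]) (simp add: subspace_scale[OF S] tendsto_scaleR)
  qed
qed

text \<open>\<open>closed_cspan\<close> is a closed real span of complex multiples. It is invariant
  under complex scalars because such a multiplication is continuous, real linear and maps the
  generators \<open>X\<close> into themselves.\<close>

lemma closed_cspan_least:
  assumes "A \<subseteq> closed_cspan B"
  shows "closed_cspan A \<subseteq> closed_cspan (B :: 'a::complex_inner set)"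
proof -
  define X where "X = {c *\<^sub>C x |c x. x \<in> B}"
  have X: "(\<lambda>x. c *\<^sub>C x) ` X \<subseteq> X" for c
    by (auto simp: X_def scaleC_scaleC) blast
  have "(\<lambda>x. c *\<^sub>C x) ` closure (span X) \<subseteq> closure (span X)" for c
  proof -
    have "(\<lambda>x. c *\<^sub>C x) ` closure (span X) \<subseteq> closure ((\<lambda>x. c *\<^sub>C x) ` span X)"
      by (intro continuous_image_closure_subset[of UNIV] linear_continuous_on bounded_linear_scaleC) auto
    also have "(\<lambda>x. c *\<^sub>C x) ` span X = span ((\<lambda>x. c *\<^sub>C x) ` X)"
      by (rule linear_span_image[symmetric]) (rule bounded_linear.linear[OF bounded_linear_scaleC])
    also have "closure \<dots> \<subseteq> closure (span X)"
      by (intro closure_mono span_mono X)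
    finally show ?thesis .
  qed
  then have "{c *\<^sub>C x |c x. x \<in> A} \<subseteq> closure (span X)"
    using assms unfolding closed_cspan_def X_def[symmetric] by blast
  then have "span {c *\<^sub>C x |c x. x \<in> A} \<subseteq> closure (span X)"
    by (rule span_minimal) (intro subspace_closure subspace_span)
  then show ?thesis
    unfolding closed_cspan_def X_def[symmetric] by (rule closure_minimal) simp
qed

lemma closed_cspan_superset: "A \<subseteq> closed_cspan (A :: 'a::complex_inner set)"
proof -
  have "A \<subseteq> {c *\<^sub>C x |c x. x \<in> A}"
    by (auto intro!: exI[of _ 1])
  also have "\<dots> \<subseteq> closed_cspan A"
    unfolding closed_cspan_def by (rule order_trans[OF span_superset closure_subset])
  finally show ?thesis .
qed

text \<open>Flattens the nested closed spans in the definition of minimality to the orbit vectors,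
  whose inner products are computable.\<close>

lemma minimal_coupling_dense:
  assumes "minimal_coupling \<sigma>"
  shows "closed_cspan (range (\<lambda>(k, f). zpow (cpl_U \<sigma>) k (cpl_VF \<sigma> f)) \<union>
    range (\<lambda>(k, g). zpow (cpl_U \<sigma>) k (cpl_VG \<sigma> g))) = UNIV" (is "closed_cspan (?F \<union> ?G) = _")
proof -
  have "(\<Union>k. zpow (cpl_U \<sigma>) k ` range (cpl_VF \<sigma>)) = ?F"
    "(\<Union>k. zpow (cpl_U \<sigma>) k ` range (cpl_VG \<sigma>)) = ?G" by auto
  then have "closed_cspan (closed_cspan ?F \<union> closed_cspan ?G) = UNIV"
    using assms by (simp add: minimal_coupling_def wandering_sum_def)
  moreover have "closed_cspan ?F \<union> closed_cspan ?G \<subseteq> closed_cspan (?F \<union> ?G)"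
    using closed_cspan_superset[of "?F \<union> ?G"]
    by (intro Un_least closed_cspan_least) auto
  ultimately show ?thesis using closed_cspan_least[of "closed_cspan ?F \<union> closed_cspan ?G" "?F \<union> ?G"] by auto
qed

text \<open>The spanning vectors have arguments in the unprimed summands. Their inner products, also
  with the two corner vectors, come from the wandering relations, from the right column of
  \<open>\<Xi>\<close> or from its lower row, all shared with \<open>\<Xi>'\<close>. Density then
  yields the one inner product that involves the block 11.\<close>

lemma cinner_corner_determined:
  fixes \<sigma> :: "('h::separable_hilbert, 'f1::separable_hilbert \<times> 'f::separable_hilbert,
      'g1::separable_hilbert \<times> 'g::separable_hilbert) coupling"
    and \<sigma>' :: "('k::separable_hilbert, 'f1 \<times> 'f, 'g1 \<times> 'g) coupling"
  assumes \<sigma>: "unitary_coupling \<sigma>" "scattering_suboperator \<sigma> \<Xi>" "minimal_coupling (coupling22 \<sigma>)"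
    and \<sigma>': "unitary_coupling \<sigma>'" "scattering_suboperator \<sigma>' \<Xi>'"
    and right: "\<And>g. AE t in circle. \<Xi>' t (0, g) = \<Xi> t (0, g)"
    and lower: "\<And>g. AE t in circle. snd (\<Xi>' t (g, 0)) = snd (\<Xi> t (g, 0))"
  shows "(LINT t|circle. cinner (\<Xi>' t (a, 0)) (t powi k *\<^sub>C (b, 0))) =
    (LINT t|circle. cinner (\<Xi> t (a, 0)) (t powi k *\<^sub>C (b, 0)))"
proof -
  define F G where "F j f = zpow (cpl_U \<sigma>) j (cpl_VF \<sigma> f)"
    and "G j g = zpow (cpl_U \<sigma>) j (cpl_VG \<sigma> g)" for j f g
  define F' G' where "F' j f = zpow (cpl_U \<sigma>') j (cpl_VF \<sigma>' f)"
    and "G' j g = zpow (cpl_U \<sigma>') j (cpl_VG \<sigma>' g)" for j f g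
  have meas: "(\<lambda>t. \<Theta> t g) \<in> borel_measurable circle"
    if "scattering_suboperator \<rho> \<Theta>" for \<rho> :: "('l::separable_hilbert, 'f1 \<times> 'f, 'g1 \<times> 'g) coupling" and \<Theta> g
    using that unfolding scattering_suboperator_def CM_def by blast
  note [measurable] = meas[OF \<sigma>(2)] meas[OF \<sigma>'(2)]
  have FF: "cinner (F' i x) (F' j y) = cinner (F i x) (F j y)" for i j x y
    using \<sigma>(1) \<sigma>'(1) by (simp add: F_def F'_def unitary_coupling_def cinner_wandering)
  have GG: "cinner (G' i x) (G' j y) = cinner (G i x) (G j y)" for i j x y
    using \<sigma>(1) \<sigma>'(1) by (simp add: G_def G'_def unitary_coupling_def cinner_wandering)
  have GF: "cinner (G' i x) (F' j y) = cinner (G i x) (F j y)"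
    if "AE t in circle. cinner (\<Xi>' t x) (t powi (j - i) *\<^sub>C y) = cinner (\<Xi> t x) (t powi (j - i) *\<^sub>C y)" for i j x y
    using that unfolding F_def G_def F'_def G'_def cinner_coupling[OF \<sigma>(1,2)] cinner_coupling[OF \<sigma>'(1,2)]
    by (intro integral_cong_AE) measurable
  have GF_right: "cinner (G' i (0, g)) (F' j y) = cinner (G i (0, g)) (F j y)" for i j g y
    by (rule GF) (use right[of g] in eventually_elim, simp)
  have GF_lower: "cinner (G' i (g, 0)) (F' j (0, f)) = cinner (G i (g, 0)) (F j (0, f))" for i j g f
    by (rule GF) (use lower[of g] in eventually_elim, simp add: cinner_prod_def scaleC_prod_def)
  \<comment> \<open>\<open>GF_right\<close> and \<open>GF_lower\<close> give the products of a
    \<open>G\<close> vector with an \<open>F\<close> vector in this order only; conjugate symmetry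
    supplies the reverse order.\<close>
  have swap: "inner (c *\<^sub>C x) (d *\<^sub>C y) = inner (c *\<^sub>C x') (d *\<^sub>C y')"
    if "cinner x' y' = cinner x y \<or> cinner y' x' = cinner y x"
    for c d and x y :: 'h and x' y' :: 'k
    using that cinner_commute[of x y] cinner_commute[of x' y']
    by (auto simp: inner_eq_cinner cinner_scaleC_left cinner_scaleC_right)
  \<comment> \<open>All complex multiples are included because \<open>span\<close> is real; the
    first components are then exactly the generators in \<open>closed_cspan\<close>.\<close>
  define R where "R = {(c *\<^sub>C F i (0, f), c *\<^sub>C F' i (0, f)) |c i f. True} \<union>
    {(c *\<^sub>C G i (0, g), c *\<^sub>C G' i (0, g)) |c i g. True}"
  \<comment> \<open>The free scalar \<open>c\<close> is what \<open>cinner_eqI\<close> requires to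
    pass from real to complex inner products.\<close>
  have "inner (c *\<^sub>C G 0 (a, 0)) (F k (b, 0)) = inner (c *\<^sub>C G' 0 (a, 0)) (F' k (b, 0))" for c
  proof (rule inner_eq_of_gram_eq[of R])
    show "inner (fst p) (fst q) = inner (snd p) (snd q)" if "p \<in> R" "q \<in> R" for p q
      using that unfolding R_def by (auto intro!: swap simp: FF GG GF_right)
    have "fst ` R = {c *\<^sub>C x |c x. x \<in> range (\<lambda>(k, f). F k (0, f)) \<union> range (\<lambda>(k, g). G k (0, g))}"
      unfolding R_def image_Un by (force simp: image_iff)
    then show "closure (span (fst ` R)) = UNIV"
      using minimal_coupling_dense[OF \<sigma>(3)] by (simp add: closed_cspan_def coupling22_def F_def G_def)
    show "inner (fst p) (c *\<^sub>C G 0 (a, 0)) = inner (snd p) (c *\<^sub>C G' 0 (a, 0))" if "p \<in> R" for p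
      using that unfolding R_def by (auto intro!: swap simp: GG GF_lower)
    show "inner (fst p) (F k (b, 0)) = inner (snd p) (F' k (b, 0))" if "p \<in> R" for p
      using that unfolding R_def
      by (auto simp: inner_eq_cinner cinner_scaleC_left FF GF_right)
    have "norm (G 0 (a, 0)) = norm (G' 0 (a, 0))"
      using GG[of 0 "(a, 0)" 0 "(a, 0)"] by (simp add: norm_eq_sqrt_inner inner_eq_cinner)
    then show "norm (c *\<^sub>C G 0 (a, 0)) = norm (c *\<^sub>C G' 0 (a, 0))" by (simp add: norm_scaleC)
  qed
  then have "cinner (G 0 (a, 0)) (F k (b, 0)) = cinner (G' 0 (a, 0)) (F' k (b, 0))"
    by (rule cinner_eqI)
  then show ?thesis
    unfolding F_def G_def F'_def G'_def cinner_coupling[OF \<sigma>(1,2)] cinner_coupling[OF \<sigma>'(1,2)] by simp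
qed

section \<open>From scalar Fourier coefficients to the operator block\<close>

lemma CM_in_L2:
  assumes "\<Theta> \<in> CM" shows "(\<lambda>t. \<Theta> t g) \<in> L2"
proof -
  have [measurable]: "(\<lambda>t. \<Theta> t g) \<in> borel_measurable circle" using assms by (simp add: CM_def)
  have lin: "\<forall>t\<in>sphere 0 1. bounded_clinear (\<Theta> t)" and b: "AE t in circle. onorm (\<Theta> t) \<le> 1"
    using assms by (simp_all add: CM_def)
  have "AE t in circle. norm ((norm (\<Theta> t g))\<^sup>2) \<le> (norm g)\<^sup>2"
    using b AE_circle_sphere
  proof eventually_elim
    case (elim t)
    then have "bounded_linear (\<Theta> t)" using lin by (auto simp: bounded_clinear_def)
    from onorm[OF this, of g] mult_right_mono[OF elim(1) norm_ge_zero[of g]]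
    have "norm (\<Theta> t g) \<le> norm g" by simp
    then show ?case by (simp add: power_mono)
  qed
  then have "integrable circle (\<lambda>t. (norm (\<Theta> t g))\<^sup>2)"
    by (rule circle.integrable_const_bound) measurable
  then show ?thesis by (simp add: L2_def)
qed

lemma bounded_linear_eq_on_dense:
  assumes "bounded_linear S" "bounded_linear T"
    and D: "closure D = UNIV" and eq: "\<And>x. x \<in> D \<Longrightarrow> S x = T x"
  shows "S = T"
proof
  fix x
  have "closed {x. S x = T x}"
    by (intro closed_Collect_eq linear_continuous_on assms)
  then have "closure D \<subseteq> {x. S x = T x}" using eq by (intro closure_minimal) auto
  then show "S x = T x" using D by auto
qed

lemma separable_dense:
  obtains D :: "'a::second_countable_topology set" where "countable D" "closure D = UNIV"
proof -
  obtain D :: "'a set" where D: "countable D" "\<And>X. open X \<Longrightarrow> X \<noteq> {} \<Longrightarrow> \<exists>d\<in>D. d \<in> X"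
    using countable_dense_exists by blast
  have "closure D = UNIV"
    by (metis D(2) ComplD Compl_empty_eq closure_subset double_complement open_Compl closed_closure subsetD)
  with D(1) show thesis by (rule that)
qed

theorem corollary4p23:
  fixes \<theta> :: "complex \<Rightarrow> 'g::separable_hilbert \<Rightarrow> 'f::separable_hilbert"
    and \<Xi> \<Xi>' :: "complex \<Rightarrow> 'g1::separable_hilbert \<times> 'g \<Rightarrow> 'f1::separable_hilbert \<times> 'f"
  assumes "\<theta> \<in> CM"
    and "regular_extension TYPE('h::separable_hilbert) \<theta> \<Xi>"
    and "regular_extension TYPE('k::separable_hilbert) \<theta> \<Xi>'"
    and "AE t in circle. block12 \<Xi>' t = block12 \<Xi> t"
    and "AE t in circle. block21 \<Xi>' t = block21 \<Xi> t"
  shows "AE t in circle. block11 \<Xi>' t = block11 \<Xi> t"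
proof -
  have CM: "\<Xi> \<in> CM" "\<Xi>' \<in> CM" and ext: "AE t in circle. block22 \<Xi> t = \<theta> t" "AE t in circle. block22 \<Xi>' t = \<theta> t"
    using assms(2,3) by (auto simp: regular_extension_def up_leftward_extension_def)
  have right: "AE t in circle. \<Xi>' t (0, g) = \<Xi> t (0, g)" for g
    using assms(4) ext
  proof eventually_elim
    case (elim t)
    then show ?case by (metis block12_def block22_def prod_eqI)
  qed
  have lower: "AE t in circle. snd (\<Xi>' t (g, 0)) = snd (\<Xi> t (g, 0))" for g
    using assms(5) by eventually_elim (metis block21_def)
  obtain \<sigma> :: "('h, 'f1 \<times> 'f, 'g1 \<times> 'g) coupling" where
    \<sigma>: "unitary_coupling \<sigma>" "scattering_suboperator \<sigma> \<Xi>" "minimal_coupling (coupling22 \<sigma>)"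
    using assms(2) by (auto simp: regular_extension_def)
  obtain \<sigma>' :: "('k, 'f1 \<times> 'f, 'g1 \<times> 'g) coupling" where
    \<sigma>': "unitary_coupling \<sigma>'" "scattering_suboperator \<sigma>' \<Xi>'"
    using assms(3) by (auto simp: regular_extension_def)
  \<comment> \<open>For fixed \<open>a\<close> and \<open>b\<close> the difference of matrix entries
    is a scalar integrable function with vanishing Fourier coefficients; the exceptional null set
    still depends on \<open>a\<close> and \<open>b\<close>.\<close>
  have weak: "AE t in circle. cinner (block11 \<Xi>' t a) b = cinner (block11 \<Xi> t a) b" for a b
  proof -
    define \<psi> where "\<psi> t = cinner (\<Xi>' t (a, 0)) (b, 0) - cinner (\<Xi> t (a, 0)) (b, 0)" for t
    have int: "integrable circle (\<lambda>t. cinner (\<Theta> t (a, 0)) (t powi k *\<^sub>C (b, 0)))"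
      if "\<Theta> \<in> CM" for \<Theta> :: "complex \<Rightarrow> 'g1 \<times> 'g \<Rightarrow> 'f1 \<times> 'f" and k
      by (rule L2_cinner_integrable[OF CM_in_L2[OF that]])
    have "null_fourier \<psi>"
      unfolding null_fourier_def
    proof (intro conjI allI)
      show "integrable circle \<psi>"
        unfolding \<psi>_def using int[OF CM(1), of 0] int[OF CM(2), of 0] by simp
      fix k
      \<comment> \<open>The second slot of \<open>cinner\<close> is conjugate linear and conjugation
        inverts powers of \<open>t\<close> on the circle, which turns \<open>k\<close> into
        \<open>- k\<close>.\<close>
      have "(LINT t|circle. t powi k * \<psi> t) =
        (LINT t|circle. cinner (\<Xi>' t (a, 0)) (t powi (- k) *\<^sub>C (b, 0)) - cinner (\<Xi> t (a, 0)) (t powi (- k) *\<^sub>C (b, 0)))"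
        by (intro Bochner_Integration.integral_cong)
          (simp_all add: \<psi>_def cinner_scaleC_right cnj_powi_circle right_diff_distrib del: complex_cnj_power_int)
      also have "\<dots> = 0"
        using int[OF CM(1), of "- k"] int[OF CM(2), of "- k"]
          cinner_corner_determined[OF \<sigma> \<sigma>' right lower, of a "- k" b] by simp
      finally show "(LINT t|circle. t powi k * \<psi> t) = 0" .
    qed
    then have "AE t in circle. \<psi> t = 0" by (rule null_fourier_AE)
    then show ?thesis
      by eventually_elim (simp add: \<psi>_def block11_def cinner_prod_def)
  qed
  \<comment> \<open>Countable dense sets allow the null sets to be merged into one, outside of which
    boundedness extends the equality to all vectors.\<close>
  obtain A :: "'g1 set" where A: "countable A" "closure A = UNIV" by (rule separable_dense)
  obtain B :: "'f1 set" where B: "countable B" "closure B = UNIV" by (rule separable_dense)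
  have "AE t in circle. \<forall>a\<in>A. \<forall>b\<in>B. cinner (block11 \<Xi>' t a) b = cinner (block11 \<Xi> t a) b"
    using A(1) B(1) weak by (simp add: AE_ball_countable)
  with AE_circle_sphere show ?thesis
  proof eventually_elim
    case (elim t)
    have lin: "bounded_linear (block11 \<Theta> t)" if "\<Theta> \<in> CM" for \<Theta> :: "complex \<Rightarrow> 'g1 \<times> 'g \<Rightarrow> 'f1 \<times> 'f"
    proof -
      have "bounded_linear (\<Theta> t)" using that elim(1) by (auto simp: CM_def bounded_clinear_def)
      from bounded_linear_compose[OF bounded_linear_fst bounded_linear_compose[OF this
          bounded_linear_Pair[OF bounded_linear_ident bounded_linear_zero]]]
      show ?thesis by (simp add: block11_def[abs_def])
    qed
    show ?case
    proof (rule bounded_linear_eq_on_dense[OF lin[OF CM(2)] lin[OF CM(1)] A(2)])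
      fix a assume "a \<in> A"
      then have "inner (block11 \<Xi>' t a) b = inner (block11 \<Xi> t a) b" if "b \<in> B" for b
        using elim(2) that by (simp add: inner_eq_cinner)
      \<comment> \<open>Density of \<open>B\<close> first gives equality of the vectors at each
        \<open>a\<close> in \<open>A\<close>; density of \<open>A\<close> then gives equality of the
        operators.\<close>
      then have "inner (block11 \<Xi>' t a) = inner (block11 \<Xi> t a)"
        by (intro bounded_linear_eq_on_dense[OF bounded_linear_inner_right bounded_linear_inner_right B(2)])
      then show "block11 \<Xi>' t a = block11 \<Xi> t a"
        by - (rule inner_ext, metis inner_commute)
    qed
  qed
qed

end
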